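(* Let $m\ge2$, and let $S^m\subset\mathbb{R}^{m+1}$ be the unit sphere. For $\delta\in\Delta_{m+1}$ put $$\Gamma_m(\delta)=\min\Bigl\{\prod_{i=1}^m\delta_i,\ \delta_{m+1}^{1/2}\prod_{i=2}^m\delta_i,\ \delta_{m+1}\prod_{i=3}^m\delta_i\Bigr\}$$ (empty products equal $1$). There are constants $0<c<C<\infty$, depending only on $m$, such that $$c\,\Gamma_m(\delta)^{-1}\le N(S^m;\delta)\le C\,\Gamma_m(\delta)^{-1}$$ for every $\delta\in\Delta_{m+1}$ with $\delta_1$ sufficiently small.
   Context: An open box in $\mathbb{R}^n$ is an open rectangular box with positive side lengths and arbitrary orientation; its side lengths in decreasing order are $l_1(B)\ge\cdots\ge l_n(B)>0$. Let $\Delta_n=\{\delta\in(0,1)^n:\delta_1\ge\cdots\ge\delta_n\}$. For non-empty bounded $F\subset\mathbb{R}^n$ and $\delta\in\Delta_n$, $N(F;\delta)$ is the least number of open boxes $B$ needed to cover $F$, subject to $l_i(B)\le\delta_i$ for $1\le i\le n$ for every box in the cover (boxes may have different orientations). Here $n=m+1$. *)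

theory Defs
  imports "HOL-Analysis.Analysis"
begin

(* Vectors of lengths are functions on nat of which only the entries 1, ..., n matter. *)

definition Delta :: "nat \<Rightarrow> (nat \<Rightarrow> real) set" where
  "Delta n = {\<delta>. (\<forall>i\<in>{1..n}. 0 < \<delta> i \<and> \<delta> i < 1) \<and> antimono_on {1..n} \<delta>}"

(* The box has centre a, axes along the orthonormal frame u, and side lengths l. Requiring l to
   be sorted makes l i the i-th largest side length of B, uniquely determined by B for
   1 \<le> i \<le> n; permuting u shows that the ordering is no restriction on B. *)

definition open_box :: "(nat \<Rightarrow> real) \<Rightarrow> (real ^ 'n) set \<Rightarrow> bool" where
  "open_box l B \<longleftrightarrow>
     (\<forall>i\<in>{1..CARD('n)}. 0 < l i) \<and> antimono_on {1..CARD('n)} l \<and>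
     (\<exists>a u. (\<forall>i\<in>{1..CARD('n)}. \<forall>j\<in>{1..CARD('n)}. u i \<bullet> u j = (if i = j then 1 else 0)) \<and>
            B = {x. \<forall>i\<in>{1..CARD('n)}. \<bar>(x - a) \<bullet> u i\<bar> < l i / 2})"

definition box_cover :: "(real ^ 'n) set \<Rightarrow> (nat \<Rightarrow> real) \<Rightarrow> (real ^ 'n) set set \<Rightarrow> bool" where
  "box_cover F \<delta> \<B> \<longleftrightarrow>
     F \<subseteq> \<Union>\<B> \<and> (\<forall>B\<in>\<B>. \<exists>l. open_box l B \<and> (\<forall>i\<in>{1..CARD('n)}. l i \<le> \<delta> i))"

(* Only meaningful for bounded F and positive \<delta>, where a finite cover exists. *)

definition box_covering_number :: "(real ^ 'n) set \<Rightarrow> (nat \<Rightarrow> real) \<Rightarrow> nat" where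
  "box_covering_number F \<delta> = (LEAST k. \<exists>\<B>. finite \<B> \<and> card \<B> = k \<and> box_cover F \<delta> \<B>)"

definition Gamma_box :: "nat \<Rightarrow> (nat \<Rightarrow> real) \<Rightarrow> real" where
  "Gamma_box m \<delta> = Min {\<Prod>i=1..m. \<delta> i,
                        \<delta> (m + 1) powr (1/2) * (\<Prod>i=2..m. \<delta> i),
                        \<delta> (m + 1) * (\<Prod>i=3..m. \<delta> i)}"

end

theory Submission
  imports Defs
begin

text \<open>
  Write \<open>d\<close> for \<open>\<delta> (m + 1)\<close> and \<open>\<Gamma>\<close> for \<open>Gamma_box m \<delta>\<close>. Since \<open>\<delta>\<close> is decreasing,
  \<open>\<Gamma> = min (\<delta> 1) (sqrt d) * min (\<delta> 2) (sqrt d) * (\<Prod>i=3..m. \<delta> i)\<close>.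

  \<^bold>\<open>Lower bound.\<close> Volumes are compared in the shell \<open>1 \<le> \<bar>y\<bar>\<^sup>2 \<le> 1 + d\<close>, whose volume is at least a constant
  times \<open>d\<close>. Radial projection moves a point of the shell by at most \<open>d / 2\<close>, so enlarging the boxes
  of a cover of the sphere to side lengths \<open>2 * \<delta> i\<close> gives a cover of the shell, and it is
  enough that such a box meets the shell in volume \<open>O(d * \<Gamma>)\<close>. In coordinates along the axes of the box,
  some coordinate \<open>y\<^sub>k\<close> stays away from \<open>0\<close>, because the box is small and meets the shell. Given
  the other coordinates, \<open>y\<^sub>k\<^sup>2\<close> ranges over an interval of length \<open>d\<close>, so \<open>y\<^sub>k\<close> contributes \<open>O(d)\<close>
  (\<open>emeasure_box_shell_remove_le\<close>). As \<open>y\<^sub>k\<close> itself moves by \<open>O(\<delta> k)\<close> only, the other coordinates are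
  confined to a thicker shell: the sum of their squares ranges over an interval of length \<open>O(\<delta> k)\<close>.
  Ignoring this restriction they contribute \<open>\<Prod>i\<noteq>k. \<delta> i\<close>; using it to confine \<open>y\<^sub>1\<close> replaces the
  factor \<open>\<delta> 1\<close> by \<open>sqrt (\<delta> k)\<close>; using it to confine \<open>(y\<^sub>1, y\<^sub>2)\<close> to a planar annulus replaces
  \<open>\<delta> 1 * \<delta> 2\<close> by \<open>\<delta> k\<close>, since the area of an annulus depends only on the difference of the
  squared radii. For \<open>k = m + 1\<close> these are the three products in the definition of \<open>\<Gamma>\<close>, and
  the other \<open>k\<close> do not give more (\<open>emeasure_box_shell_le_Gamma_box\<close>).

  \<^bold>\<open>Upper bound.\<close> Put \<open>\<rho> = max (sqrt d) (\<delta> 3)\<close>; by a packing argument \<open>O(\<rho> powr -m)\<close> caps of radius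
  \<open>\<rho> / 16\<close> cover the sphere (\<open>sphere_net\<close>). If \<open>\<rho> = sqrt d\<close>, each cap is flat up to height \<open>d\<close> and
  can be cut into cells of side lengths \<open>min (\<delta> i) \<rho>\<close>. If \<open>\<rho> = \<delta> 3\<close> is larger, a cap has height about
  \<open>\<rho>\<^sup>2\<close>, too much for one box. However, a slab of thickness \<open>d\<close> at depth about \<open>\<rho>\<^sup>2\<close> below a point
  \<open>u\<close> of the sphere cuts out a band of width about \<open>d / \<rho>\<close> around a circle of latitude of radius
  about \<open>\<rho>\<close>, and tilting \<open>u\<close> in steps of \<open>d / \<rho>\<close> sweeps this band over the whole cap. So
  \<open>O(\<rho>\<^sup>2 / d)\<close> slabs cover the cap (\<open>tilted_slab_exists\<close>), and the other \<open>m\<close> coordinates are cut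
  into cells of side lengths \<open>min (\<delta> i) \<rho>\<close> (\<open>cap_box_cover\<close>). Since the sweep takes a bounded number of
  steps when \<open>\<rho> = sqrt d\<close>, this construction serves in both cases. The total number of boxes is
  \<open>O(\<rho>\<^sup>2 / (d * (\<Prod>i=1..m. min (\<delta> i) \<rho>)))\<close>, which is \<open>O(1 / \<Gamma>)\<close> by \<open>Gamma_box_le_cell_product\<close>.
\<close>

section \<open>Volume bounds from sections\<close>

interpretation lborel_product: product_sigma_finite "\<lambda>_::'i. lborel :: real measure"
  by standard

text \<open>Fubini, in the form in which volumes are estimated below: coordinates are peeled off one at a time,
  and the base \<open>A'\<close> need only contain the projection of \<open>A\<close>.\<close>

lemma emeasure_PiM_insert_section_le:
  fixes A A' :: "('i \<Rightarrow> real) set" and S :: "('i \<Rightarrow> real) \<Rightarrow> real set"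
  assumes I: "finite I" "k \<notin> I"
    and A: "A \<in> sets (PiM (insert k I) (\<lambda>_. lborel))"
    and A': "A' \<in> sets (PiM I (\<lambda>_. lborel))"
    and sub: "\<And>g t. g(k := t) \<in> A \<Longrightarrow> g \<in> space (PiM I (\<lambda>_. lborel)) \<Longrightarrow> g \<in> A' \<and> t \<in> S g"
    and S: "\<And>g. S g \<in> sets lborel" "\<And>g. g \<in> A' \<Longrightarrow> emeasure lborel (S g) \<le> c"
  shows "emeasure (PiM (insert k I) (\<lambda>_. lborel)) A \<le> c * emeasure (PiM I (\<lambda>_. lborel)) A'"
proof -
  have "emeasure (PiM (insert k I) (\<lambda>_. lborel)) A
      = (\<integral>\<^sup>+ f. indicator A f \<partial>PiM (insert k I) (\<lambda>_. lborel))"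
    using A by simp
  also have "\<dots> = (\<integral>\<^sup>+ g. (\<integral>\<^sup>+ t. indicator A (g(k := t)) \<partial>lborel) \<partial>PiM I (\<lambda>_. lborel))"
    using A by (intro lborel_product.product_nn_integral_insert I) auto
  also have "\<dots> \<le> (\<integral>\<^sup>+ g. c * indicator A' g \<partial>PiM I (\<lambda>_. lborel))"
  proof (rule nn_integral_mono)
    fix g assume g: "g \<in> space (PiM I (\<lambda>_. lborel :: real measure))"
    have "(\<integral>\<^sup>+ t. indicator A (g(k := t)) \<partial>lborel)
        \<le> (\<integral>\<^sup>+ t. indicator A' g * indicator (S g) t \<partial>lborel)"
      by (rule nn_integral_mono) (use sub[OF _ g] in \<open>auto simp: indicator_def\<close>)
    also have "\<dots> = indicator A' g * emeasure lborel (S g)"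
      using S(1) by (simp add: nn_integral_cmult_indicator)
    also have "\<dots> \<le> c * indicator A' g"
      using S(2)[of g] by (auto simp: indicator_def)
    finally show "(\<integral>\<^sup>+ t. indicator A (g(k := t)) \<partial>lborel) \<le> c * indicator A' g" .
  qed
  also have "\<dots> = c * emeasure (PiM I (\<lambda>_. lborel)) A'"
    using A' by (simp add: nn_integral_cmult_indicator)
  finally show ?thesis .
qed

text \<open>The same bound with planar fibres. An annulus cannot be treated one coordinate at a time, since the
  sections of a thin annulus near its tangent lines are much longer than its area divided by its diameter.\<close>

lemma emeasure_PiM_insert2_section_le:
  fixes A A' :: "('i \<Rightarrow> real) set" and S :: "('i \<Rightarrow> real) \<Rightarrow> (real \<times> real) set"
  assumes I: "finite I" "j \<notin> I" "k \<notin> I" "j \<noteq> k"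
    and A: "A \<in> sets (PiM (insert j (insert k I)) (\<lambda>_. lborel))"
    and A': "A' \<in> sets (PiM I (\<lambda>_. lborel))"
    and sub: "\<And>g s t. g(k := t, j := s) \<in> A \<Longrightarrow> g \<in> space (PiM I (\<lambda>_. lborel)) \<Longrightarrow> g \<in> A' \<and> (t, s) \<in> S g"
    and S: "\<And>g. S g \<in> sets lborel" "\<And>g. g \<in> A' \<Longrightarrow> emeasure lborel (S g) \<le> c"
  shows "emeasure (PiM (insert j (insert k I)) (\<lambda>_. lborel)) A \<le> c * emeasure (PiM I (\<lambda>_. lborel)) A'"
proof -
  have "emeasure (PiM (insert j (insert k I)) (\<lambda>_. lborel)) A
      = (\<integral>\<^sup>+ f. indicator A f \<partial>PiM (insert j (insert k I)) (\<lambda>_. lborel))"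
    using A by simp
  also have "\<dots> = (\<integral>\<^sup>+ g. (\<integral>\<^sup>+ s. indicator A (g(j := s)) \<partial>lborel) \<partial>PiM (insert k I) (\<lambda>_. lborel))"
    using A I by (intro lborel_product.product_nn_integral_insert) auto
  also have "\<dots> = (\<integral>\<^sup>+ g. (\<integral>\<^sup>+ t. (\<integral>\<^sup>+ s. indicator A (g(k := t, j := s)) \<partial>lborel) \<partial>lborel) \<partial>PiM I (\<lambda>_. lborel))"
  proof (rule lborel_product.product_nn_integral_insert)
    have [measurable]: "(\<lambda>(g, s). g(j := s)) \<in> PiM (insert k I) (\<lambda>_. lborel) \<Otimes>\<^sub>M lborel \<rightarrow>\<^sub>M
        PiM (insert j (insert k I)) (\<lambda>_. lborel :: real measure)"
      by (rule measurable_add_dim)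
    have "(\<lambda>(g, s). indicator A (g(j := s)) :: ennreal) \<in>
        borel_measurable (PiM (insert k I) (\<lambda>_. lborel) \<Otimes>\<^sub>M lborel)"
      using measurable_compose[OF measurable_add_dim borel_measurable_indicator[OF A]]
      by (simp add: case_prod_beta')
    then show "(\<lambda>g. \<integral>\<^sup>+ s. indicator A (g(j := s)) \<partial>lborel) \<in> borel_measurable (PiM (insert k I) (\<lambda>_. lborel))"
      using lborel.borel_measurable_nn_integral[of "\<lambda>g s. indicator A (g(j := s))"] by simp
  qed (use I in auto)
  also have "\<dots> \<le> (\<integral>\<^sup>+ g. c * indicator A' g \<partial>PiM I (\<lambda>_. lborel))"
  proof (rule nn_integral_mono)
    fix g assume g: "g \<in> space (PiM I (\<lambda>_. lborel :: real measure))"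
    have [measurable]: "S g \<in> sets borel" using S(1)[of g] by simp
    have "(\<integral>\<^sup>+ t. (\<integral>\<^sup>+ s. indicator A (g(k := t, j := s)) \<partial>lborel) \<partial>lborel)
        \<le> (\<integral>\<^sup>+ t. (\<integral>\<^sup>+ s. indicator A' g * indicator (S g) (t, s) \<partial>lborel) \<partial>lborel)"
      by (intro nn_integral_mono) (use sub[OF _ g] in \<open>auto simp: indicator_def\<close>)
    also have "\<dots> = indicator A' g * (\<integral>\<^sup>+ t. (\<integral>\<^sup>+ s. indicator (S g) (t, s) \<partial>lborel) \<partial>lborel)"
      by (auto simp: indicator_def)
    also have "(\<integral>\<^sup>+ t. (\<integral>\<^sup>+ s. indicator (S g) (t, s) \<partial>lborel) \<partial>lborel) = emeasure lborel (S g)"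
      using lborel.nn_integral_fst[of "indicator (S g)" lborel] S(1)[of g]
      by (simp add: lborel_prod)
    also have "indicator A' g * emeasure lborel (S g) \<le> c * indicator A' g"
      using S(2)[of g] by (auto simp: indicator_def)
    finally show "(\<integral>\<^sup>+ t. (\<integral>\<^sup>+ s. indicator A (g(k := t, j := s)) \<partial>lborel) \<partial>lborel) \<le> c * indicator A' g" .
  qed
  also have "\<dots> = c * emeasure (PiM I (\<lambda>_. lborel)) A'"
    using A' by (simp add: nn_integral_cmult_indicator)
  finally show ?thesis .
qed

text \<open>The area of a disc is proportional to the square of its radius, so only the difference of the
  squared radii of an annulus matters.\<close>

lemma emeasure_planar_annulus_le:
  fixes \<sigma> w :: real
  assumes "w \<ge> 0"
  shows "{p::real \<times> real. \<sigma> \<le> (fst p)\<^sup>2 + (snd p)\<^sup>2 \<and> (fst p)\<^sup>2 + (snd p)\<^sup>2 \<le> \<sigma> + w} \<in> sets lborel" (is "?A \<in> _")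
    and "emeasure lborel {p::real \<times> real. \<sigma> \<le> (fst p)\<^sup>2 + (snd p)\<^sup>2 \<and> (fst p)\<^sup>2 + (snd p)\<^sup>2 \<le> \<sigma> + w}
      \<le> ennreal (measure lborel (ball (0::real \<times> real) 1) * w)"
proof -
  show "?A \<in> sets lborel"
  proof -
    have "closed ?A" by (intro closed_Collect_conj closed_Collect_le continuous_intros)
    then show ?thesis by simp
  qed
  define \<tau> where "\<tau> = max \<sigma> 0"
  let ?R = "sqrt (\<tau> + w)" and ?r = "sqrt \<tau>"
  let ?V = "measure lborel (ball (0::real \<times> real) 1)"
  have nsq: "(norm p)\<^sup>2 = (fst p)\<^sup>2 + (snd p)\<^sup>2" for p :: "real \<times> real"
    by (cases p) (simp add: norm_Pair)
  have \<tau>: "\<tau> \<ge> 0" "\<sigma> \<le> \<tau>" by (auto simp: \<tau>_def)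
  have "?A \<subseteq> cball 0 ?R - ball 0 ?r"
  proof
    fix p assume p: "p \<in> ?A"
    have 1: "\<tau> \<le> (norm p)\<^sup>2" "(norm p)\<^sup>2 \<le> \<tau> + w"
      using p \<tau> by (auto simp: nsq \<tau>_def)
    then have "norm p \<le> ?R" "?r \<le> norm p" 
      by (auto intro: real_le_rsqrt real_le_lsqrt)
    then show "p \<in> cball 0 ?R - ball 0 ?r" by auto
  qed
  then have "emeasure lborel ?A \<le> emeasure lborel (cball (0::real\<times>real) ?R - ball 0 ?r)"
    by (intro emeasure_mono) auto
  also have "\<dots> = emeasure lborel (cball (0::real\<times>real) ?R) - emeasure lborel (ball (0::real\<times>real) ?r)"
  proof (rule emeasure_Diff)
    have "?r \<le> ?R" using assms by simp
    then show "ball (0::real\<times>real) ?r \<subseteq> cball 0 ?R"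
      by (intro order.trans[OF ball_subset_cball] subset_cball)
    show "emeasure lborel (ball (0::real\<times>real) ?r) \<noteq> \<infinity>"
      using emeasure_lborel_ball_finite[of "0::real\<times>real" ?r] by simp
  qed auto
  also have "\<dots> = ennreal (measure lborel (cball (0::real\<times>real) ?R) - measure lborel (ball (0::real\<times>real) ?r))"
    using emeasure_lborel_ball_finite[of "0::real\<times>real" ?r] emeasure_lborel_cball_finite[of "0::real\<times>real" ?R]
    by (simp add: ennreal_minus[symmetric] emeasure_eq_ennreal_measure less_top)
  also have "measure lborel (cball (0::real\<times>real) ?R) - measure lborel (ball (0::real\<times>real) ?r) = ?V * w"
    using assms \<tau> by (simp add: content_cball_conv_ball content_ball_conv_unit_ball[of ?R] content_ball_conv_unit_ball[of ?r] algebra_simps)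
  finally show "emeasure lborel ?A \<le> ennreal (?V * w)" .
qed

text \<open>Away from \<open>0\<close> the square root is Lipschitz; near \<open>0\<close> it is only \<open>1/2\<close>-Hoelder. This is the source of
  the exponent \<open>1/2\<close> in \<open>Gamma_box\<close>.\<close>

lemma emeasure_square_root_interval_le:
  fixes \<sigma> w q :: real
  assumes "w \<ge> 0" "q > 0"
  shows "emeasure lborel {t::real. \<sigma> \<le> t\<^sup>2 \<and> t\<^sup>2 \<le> \<sigma> + w} \<le> ennreal (2 * sqrt w)"
    and "emeasure lborel {t::real. q \<le> \<bar>t\<bar> \<and> \<sigma> \<le> t\<^sup>2 \<and> t\<^sup>2 \<le> \<sigma> + w} \<le> ennreal (2 * w / q)"
proof -
  have gen: "emeasure lborel {t::real. P t} \<le> ennreal (2 * c)"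
    if "\<And>t. P t \<Longrightarrow> a \<le> \<bar>t\<bar> \<and> \<bar>t\<bar> \<le> b" "b - a \<le> c" "c \<ge> 0" for P a b c
  proof -
    have "emeasure lborel {t::real. P t} \<le> emeasure lborel ({a..b} \<union> {-b..-a})"
      by (intro emeasure_mono) (use that(1) in \<open>fastforce simp: abs_if split: if_splits\<close>)+
    also have "\<dots> \<le> emeasure lborel {a..b} + emeasure lborel {-b..-a}"
      by (intro emeasure_subadditive) auto
    also have "\<dots> \<le> ennreal c + ennreal c"
      using that(2,3) by (intro add_mono) (auto simp: emeasure_lborel_Icc_eq ennreal_leI)
    also have "\<dots> = ennreal (2 * c)" using that(3) by (simp flip: ennreal_plus)
    finally show ?thesis .
  qed
  show "emeasure lborel {t::real. \<sigma> \<le> t\<^sup>2 \<and> t\<^sup>2 \<le> \<sigma> + w} \<le> ennreal (2 * sqrt w)"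
  proof (rule gen)
    define \<tau> where "\<tau> = max \<sigma> 0"
    fix t :: real assume t: "\<sigma> \<le> t\<^sup>2 \<and> t\<^sup>2 \<le> \<sigma> + w"
    then have "\<tau> \<le> \<bar>t\<bar>\<^sup>2" "\<bar>t\<bar>\<^sup>2 \<le> \<tau> + w" by (auto simp: \<tau>_def)
    then show "sqrt (max \<sigma> 0) \<le> \<bar>t\<bar> \<and> \<bar>t\<bar> \<le> sqrt (max \<sigma> 0 + w)"
      unfolding \<tau>_def[symmetric] by (auto intro: real_le_rsqrt real_le_lsqrt)
  next
    show "sqrt (max \<sigma> 0 + w) - sqrt (max \<sigma> 0) \<le> sqrt w"
      using sqrt_add_le_add_sqrt[of "max \<sigma> 0" w] assms by simp
  qed (use assms in auto)
  have "emeasure lborel {t::real. q \<le> \<bar>t\<bar> \<and> \<sigma> \<le> t\<^sup>2 \<and> t\<^sup>2 \<le> \<sigma> + w} \<le> ennreal (2 * (w / q))"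
  proof (rule gen)
    define \<tau> where "\<tau> = max \<sigma> (q\<^sup>2)"
    fix t :: real assume t: "q \<le> \<bar>t\<bar> \<and> \<sigma> \<le> t\<^sup>2 \<and> t\<^sup>2 \<le> \<sigma> + w"
    have "q\<^sup>2 \<le> \<bar>t\<bar>\<^sup>2" using t assms by (intro power_mono) auto
    then have "\<tau> \<le> \<bar>t\<bar>\<^sup>2" "\<bar>t\<bar>\<^sup>2 \<le> \<tau> + w" using t by (auto simp: \<tau>_def)
    then show "sqrt (max \<sigma> (q\<^sup>2)) \<le> \<bar>t\<bar> \<and> \<bar>t\<bar> \<le> sqrt (max \<sigma> (q\<^sup>2) + w)"
      unfolding \<tau>_def[symmetric] by (auto intro: real_le_rsqrt real_le_lsqrt)
  next
    define \<tau> where "\<tau> = max \<sigma> (q\<^sup>2)"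
    have "q\<^sup>2 > 0" "\<tau> \<ge> q\<^sup>2" using assms by (auto simp: \<tau>_def)
    then have "\<tau> > 0" "sqrt \<tau> \<ge> q" by (linarith, intro real_le_rsqrt)
    then have \<tau>: "\<tau> \<ge> 0" "sqrt \<tau> \<ge> q" "\<tau> > 0" by auto
    have "(sqrt (\<tau> + w) - sqrt \<tau>) * q \<le> (sqrt (\<tau> + w) - sqrt \<tau>) * (sqrt (\<tau> + w) + sqrt \<tau>)"
      using \<tau> assms by (intro mult_left_mono) (auto intro: add_increasing)
    also have "\<dots> = w" using \<tau> assms by (simp add: algebra_simps)
    finally show "sqrt (max \<sigma> (q\<^sup>2) + w) - sqrt (max \<sigma> (q\<^sup>2)) \<le> w / q"
      using assms by (simp add: \<tau>_def field_simps)
  qed (use assms in auto)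
  then show "emeasure lborel {t::real. q \<le> \<bar>t\<bar> \<and> \<sigma> \<le> t\<^sup>2 \<and> t\<^sup>2 \<le> \<sigma> + w} \<le> ennreal (2 * w / q)"
    by simp
qed

section \<open>Coordinate boxes cut by spherical shells\<close>

definition box_shell :: "'i set \<Rightarrow> ('i \<Rightarrow> real) \<Rightarrow> ('i \<Rightarrow> real) \<Rightarrow> real \<Rightarrow> real \<Rightarrow> ('i \<Rightarrow> real) set" where
  "box_shell I \<alpha> L \<sigma> w =
     {f \<in> space (PiM I (\<lambda>_. lborel)). (\<forall>i\<in>I. \<bar>f i - \<alpha> i\<bar> \<le> L i) \<and>
        \<sigma> \<le> (\<Sum>i\<in>I. (f i)\<^sup>2) \<and> (\<Sum>i\<in>I. (f i)\<^sup>2) \<le> \<sigma> + w}"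

lemma sets_box_shell:
  assumes "finite I"
  shows "box_shell I \<alpha> L \<sigma> w \<in> sets (PiM I (\<lambda>_. lborel))"
proof -
  have [measurable]: "Measurable.pred (PiM I (\<lambda>_. lborel)) (\<lambda>f. \<bar>f i - \<alpha> i\<bar> \<le> L i)" if "i \<in> I" for i
    using that by measurable
  have [measurable]: "Measurable.pred (PiM I (\<lambda>_. lborel)) (\<lambda>f. \<forall>i\<in>I. \<bar>f i - \<alpha> i\<bar> \<le> L i)"
    using assms by (intro pred_intros_finite) auto
  have [measurable]: "(\<lambda>f. \<Sum>i\<in>I. (f i)\<^sup>2) \<in> borel_measurable (PiM I (\<lambda>_. lborel :: real measure))"
    by measurable
  show ?thesis unfolding box_shell_def by measurable
qed

definition coordinate_box :: "'i set \<Rightarrow> ('i \<Rightarrow> real) \<Rightarrow> ('i \<Rightarrow> real) \<Rightarrow> ('i \<Rightarrow> real) set" where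
  "coordinate_box I \<alpha> L = (\<Pi>\<^sub>E i\<in>I. {\<alpha> i - L i .. \<alpha> i + L i})"

lemma
  assumes "finite I"
  shows sets_coordinate_box: "coordinate_box I \<alpha> L \<in> sets (PiM I (\<lambda>_. lborel))"
    and emeasure_coordinate_box: "(\<And>i. i \<in> I \<Longrightarrow> L i \<ge> 0) \<Longrightarrow>
      emeasure (PiM I (\<lambda>_. lborel)) (coordinate_box I \<alpha> L) = ennreal (\<Prod>i\<in>I. 2 * L i)"
proof -
  show "coordinate_box I \<alpha> L \<in> sets (PiM I (\<lambda>_. lborel))"
    unfolding coordinate_box_def by (rule sets_PiM_I_finite[OF assms]) auto
  assume L: "\<And>i. i \<in> I \<Longrightarrow> L i \<ge> 0"
  have "emeasure (PiM I (\<lambda>_. lborel)) (coordinate_box I \<alpha> L)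
      = (\<Prod>i\<in>I. emeasure lborel {\<alpha> i - L i .. \<alpha> i + L i})"
    unfolding coordinate_box_def by (intro lborel_product.emeasure_PiM assms) auto
  also have "\<dots> = (\<Prod>i\<in>I. ennreal (2 * L i))"
    using L by (intro prod.cong) (auto simp: emeasure_lborel_Icc_eq)
  also have "\<dots> = ennreal (\<Prod>i\<in>I. 2 * L i)"
    using L by (intro prod_ennreal) auto
  finally show "emeasure (PiM I (\<lambda>_. lborel)) (coordinate_box I \<alpha> L) = ennreal (\<Prod>i\<in>I. 2 * L i)" .
qed

lemma space_PiM_lborel: "space (PiM I (\<lambda>_. lborel :: real measure)) = extensional I"
  by (simp add: space_PiM PiE_def)

lemma emeasure_box_shell_le:
  assumes "finite I" "\<And>i. i \<in> I \<Longrightarrow> L i \<ge> 0"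
  shows "emeasure (PiM I (\<lambda>_. lborel)) (box_shell I \<alpha> L \<sigma> w) \<le> ennreal (\<Prod>i\<in>I. 2 * L i)"
proof -
  have "box_shell I \<alpha> L \<sigma> w \<subseteq> coordinate_box I \<alpha> L"
    by (force simp: box_shell_def coordinate_box_def space_PiM_lborel abs_le_iff extensional_def)
  then have "emeasure (PiM I (\<lambda>_. lborel)) (box_shell I \<alpha> L \<sigma> w) \<le> emeasure (PiM I (\<lambda>_. lborel)) (coordinate_box I \<alpha> L)"
    by (intro emeasure_mono sets_coordinate_box assms)
  then show ?thesis using assms by (simp add: emeasure_coordinate_box)
qed

text \<open>The shell confines \<open>f j\<close>, given the remaining coordinates, to a set of length \<open>2 * sqrt w\<close>.\<close>

lemma emeasure_box_shell_insert_le: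
  assumes "finite I" "j \<notin> I" "\<And>i. i \<in> I \<Longrightarrow> L i \<ge> 0" "w \<ge> 0"
  shows "emeasure (PiM (insert j I) (\<lambda>_. lborel)) (box_shell (insert j I) \<alpha> L \<sigma> w)
    \<le> ennreal (2 * sqrt w * (\<Prod>i\<in>I. 2 * L i))"
proof -
  let ?\<sigma> = "\<lambda>g :: _ \<Rightarrow> real. \<sigma> - (\<Sum>i\<in>I. (g i)\<^sup>2)"
  have "emeasure (PiM (insert j I) (\<lambda>_. lborel)) (box_shell (insert j I) \<alpha> L \<sigma> w)
      \<le> ennreal (2 * sqrt w) * emeasure (PiM I (\<lambda>_. lborel)) (coordinate_box I \<alpha> L)"
  proof (rule emeasure_PiM_insert_section_le[where S = "\<lambda>g. {t. ?\<sigma> g \<le> t\<^sup>2 \<and> t\<^sup>2 \<le> ?\<sigma> g + w}"])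
    show "box_shell (insert j I) \<alpha> L \<sigma> w \<in> sets (PiM (insert j I) (\<lambda>_. lborel))"
      using assms by (intro sets_box_shell) auto
    show "coordinate_box I \<alpha> L \<in> sets (PiM I (\<lambda>_. lborel))"
      using assms by (intro sets_coordinate_box) auto
  next
    fix g t assume *: "g(j := t) \<in> box_shell (insert j I) \<alpha> L \<sigma> w" and g: "g \<in> space (PiM I (\<lambda>_. lborel :: real measure))"
    have "(\<Sum>i\<in>I. ((g(j := t)) i)\<^sup>2) = (\<Sum>i\<in>I. (g i)\<^sup>2)"
      using assms by (intro sum.cong) auto
    moreover have "g i \<in> {\<alpha> i - L i .. \<alpha> i + L i}" if "i \<in> I" for i
    proof -
      have "\<bar>(g(j := t)) i - \<alpha> i\<bar> \<le> L i" using * that by (simp add: box_shell_def)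
      moreover have "i \<noteq> j" using that assms by auto
      ultimately show ?thesis by (simp add: abs_le_iff)
    qed
    then have "g \<in> coordinate_box I \<alpha> L"
      using g by (simp add: coordinate_box_def PiE_iff space_PiM_lborel)
    ultimately show "g \<in> coordinate_box I \<alpha> L \<and> t \<in> {t. ?\<sigma> g \<le> t\<^sup>2 \<and> t\<^sup>2 \<le> ?\<sigma> g + w}"
      using * assms(1,2) by (simp add: box_shell_def)
  next
    fix g :: "_ \<Rightarrow> real" 
    show "{t. ?\<sigma> g \<le> t\<^sup>2 \<and> t\<^sup>2 \<le> ?\<sigma> g + w} \<in> sets lborel" by measurable
    show "emeasure lborel {t. ?\<sigma> g \<le> t\<^sup>2 \<and> t\<^sup>2 \<le> ?\<sigma> g + w} \<le> ennreal (2 * sqrt w)"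
      using assms by (intro emeasure_square_root_interval_le(1)[of w 1]) auto
  qed (use assms in auto)
  then show ?thesis using assms by (simp add: emeasure_coordinate_box ennreal_mult' )
qed

text \<open>The shell confines \<open>(f j, f k)\<close>, given the remaining coordinates, to an annulus.\<close>

lemma emeasure_box_shell_insert2_le:
  assumes "finite I" "j \<notin> I" "k \<notin> I" "j \<noteq> k" "\<And>i. i \<in> I \<Longrightarrow> L i \<ge> 0" "w \<ge> 0"
  shows "emeasure (PiM (insert j (insert k I)) (\<lambda>_. lborel)) (box_shell (insert j (insert k I)) \<alpha> L \<sigma> w)
    \<le> ennreal (measure lborel (ball (0::real \<times> real) 1) * w * (\<Prod>i\<in>I. 2 * L i))"
proof -
  let ?\<sigma> = "\<lambda>g :: _ \<Rightarrow> real. \<sigma> - (\<Sum>i\<in>I. (g i)\<^sup>2)"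
  let ?S = "\<lambda>g. {p :: real \<times> real. ?\<sigma> g \<le> (fst p)\<^sup>2 + (snd p)\<^sup>2 \<and> (fst p)\<^sup>2 + (snd p)\<^sup>2 \<le> ?\<sigma> g + w}"
  have "emeasure (PiM (insert j (insert k I)) (\<lambda>_. lborel)) (box_shell (insert j (insert k I)) \<alpha> L \<sigma> w)
      \<le> ennreal (measure lborel (ball (0::real \<times> real) 1) * w) * emeasure (PiM I (\<lambda>_. lborel)) (coordinate_box I \<alpha> L)"
  proof (rule emeasure_PiM_insert2_section_le[where S = ?S])
    show "box_shell (insert j (insert k I)) \<alpha> L \<sigma> w \<in> sets (PiM (insert j (insert k I)) (\<lambda>_. lborel))"
      using assms by (intro sets_box_shell) auto
    show "coordinate_box I \<alpha> L \<in> sets (PiM I (\<lambda>_. lborel))"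
      using assms by (intro sets_coordinate_box) auto
  next
    fix g s t assume *: "g(k := t, j := s) \<in> box_shell (insert j (insert k I)) \<alpha> L \<sigma> w"
      and g: "g \<in> space (PiM I (\<lambda>_. lborel :: real measure))"
    have "(\<Sum>i\<in>I. ((g(k := t, j := s)) i)\<^sup>2) = (\<Sum>i\<in>I. (g i)\<^sup>2)"
      using assms by (intro sum.cong) auto
    moreover have "g i \<in> {\<alpha> i - L i .. \<alpha> i + L i}" if "i \<in> I" for i
    proof -
      have "\<bar>(g(k := t, j := s)) i - \<alpha> i\<bar> \<le> L i" using * that by (simp add: box_shell_def)
      moreover have "i \<noteq> j" "i \<noteq> k" using that assms by auto
      ultimately show ?thesis by (simp add: abs_le_iff)
    qed
    then have "g \<in> coordinate_box I \<alpha> L"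
      using g by (simp add: coordinate_box_def PiE_iff space_PiM_lborel)
    ultimately show "g \<in> coordinate_box I \<alpha> L \<and> (t, s) \<in> ?S g"
      using * assms(1-4) by (simp add: box_shell_def add_ac)
  qed (use assms emeasure_planar_annulus_le in auto)
  then show ?thesis using assms by (simp add: emeasure_coordinate_box ennreal_mult')
qed

text \<open>If \<open>\<bar>f k\<bar> \<ge> q\<close> throughout the box, then \<open>f k\<close> ranges over a set of length \<open>2 * w / q\<close> once the other
  coordinates are given. Moreover \<open>(f k)\<^sup>2\<close> differs from \<open>(\<alpha> k)\<^sup>2\<close> by at most \<open>e\<close>, so the other coordinates
  lie in a shell that is wider by \<open>2 * e\<close>.\<close>

lemma emeasure_box_shell_remove_le:
  assumes "finite I" "k \<notin> I" "w \<ge> 0" "q > 0" "L k \<ge> 0" "q \<le> \<bar>\<alpha> k\<bar> - L k"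
  defines "e \<equiv> L k * (2 * \<bar>\<alpha> k\<bar> + L k)"
  shows "emeasure (PiM (insert k I) (\<lambda>_. lborel)) (box_shell (insert k I) \<alpha> L \<sigma> w)
    \<le> ennreal (2 * w / q) * emeasure (PiM I (\<lambda>_. lborel)) (box_shell I \<alpha> L (\<sigma> - (\<alpha> k)\<^sup>2 - e) (w + 2 * e))"
proof -
  let ?\<sigma> = "\<lambda>g :: _ \<Rightarrow> real. \<sigma> - (\<Sum>i\<in>I. (g i)\<^sup>2)"
  show ?thesis
  proof (rule emeasure_PiM_insert_section_le[where S = "\<lambda>g. {t. q \<le> \<bar>t\<bar> \<and> ?\<sigma> g \<le> t\<^sup>2 \<and> t\<^sup>2 \<le> ?\<sigma> g + w}"])
    show "box_shell (insert k I) \<alpha> L \<sigma> w \<in> sets (PiM (insert k I) (\<lambda>_. lborel))"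
      using assms by (intro sets_box_shell) auto
    show "box_shell I \<alpha> L (\<sigma> - (\<alpha> k)\<^sup>2 - e) (w + 2 * e) \<in> sets (PiM I (\<lambda>_. lborel))"
      using assms by (intro sets_box_shell) auto
  next
    fix g t assume *: "g(k := t) \<in> box_shell (insert k I) \<alpha> L \<sigma> w" and g: "g \<in> space (PiM I (\<lambda>_. lborel :: real measure))"
    have eq: "(\<Sum>i\<in>I. ((g(k := t)) i)\<^sup>2) = (\<Sum>i\<in>I. (g i)\<^sup>2)"
      using assms by (intro sum.cong) auto
    have t: "\<bar>t - \<alpha> k\<bar> \<le> L k" using * by (auto simp: box_shell_def)
    have "\<bar>t\<^sup>2 - (\<alpha> k)\<^sup>2\<bar> = \<bar>t - \<alpha> k\<bar> * \<bar>t + \<alpha> k\<bar>"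
      by (simp add: power2_eq_square algebra_simps flip: abs_mult)
    also have "\<dots> \<le> e"
      unfolding e_def using t assms by (intro mult_mono) auto
    finally have "\<bar>t\<^sup>2 - (\<alpha> k)\<^sup>2\<bar> \<le> e" .
    moreover have "q \<le> \<bar>t\<bar>" using t assms by linarith
    moreover have "\<sigma> \<le> t\<^sup>2 + (\<Sum>i\<in>I. (g i)\<^sup>2)" "t\<^sup>2 + (\<Sum>i\<in>I. (g i)\<^sup>2) \<le> \<sigma> + w"
      using * assms(1,2) eq by (auto simp: box_shell_def)
    moreover have "\<forall>i\<in>I. \<bar>g i - \<alpha> i\<bar> \<le> L i"
    proof
      fix i assume "i \<in> I"
      moreover from this have "i \<noteq> k" using assms by auto
      ultimately show "\<bar>g i - \<alpha> i\<bar> \<le> L i" using * by (auto simp: box_shell_def)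
    qed
    ultimately show "g \<in> box_shell I \<alpha> L (\<sigma> - (\<alpha> k)\<^sup>2 - e) (w + 2 * e) \<and>
        t \<in> {t. q \<le> \<bar>t\<bar> \<and> ?\<sigma> g \<le> t\<^sup>2 \<and> t\<^sup>2 \<le> ?\<sigma> g + w}"
      using g unfolding box_shell_def by auto
  next
    fix g :: "_ \<Rightarrow> real" 
    show "{t. q \<le> \<bar>t\<bar> \<and> ?\<sigma> g \<le> t\<^sup>2 \<and> t\<^sup>2 \<le> ?\<sigma> g + w} \<in> sets lborel" by measurable
    show "emeasure lborel {t. q \<le> \<bar>t\<bar> \<and> ?\<sigma> g \<le> t\<^sup>2 \<and> t\<^sup>2 \<le> ?\<sigma> g + w} \<le> ennreal (2 * w / q)"
      using assms by (intro emeasure_square_root_interval_le(2)) auto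
  qed (use assms in auto)
qed

section \<open>Orthonormal frames and rotation invariance\<close>

definition orthonormal_frame :: "(nat \<Rightarrow> real ^ 'n) \<Rightarrow> bool" where
  "orthonormal_frame u \<longleftrightarrow>
     (\<forall>i\<in>{1..CARD('n)}. \<forall>j\<in>{1..CARD('n)}. u i \<bullet> u j = (if i = j then 1 else 0))"

lemma orthonormal_frame_transformation:
  fixes u :: "nat \<Rightarrow> real ^ 'n"
  assumes "orthonormal_frame u"
  obtains T \<beta> where "orthogonal_transformation T" "bij_betw \<beta> {1..CARD('n)} (Basis :: (real ^ 'n) set)"
    "\<And>x. T x = (\<Sum>i\<in>{1..CARD('n)}. (x \<bullet> \<beta> i) *\<^sub>R u i)"
proof -
  have "card {1..CARD('n)} = card (Basis :: (real ^ 'n) set)" by simp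
  then obtain \<beta> where \<beta>: "bij_betw \<beta> {1..CARD('n)} (Basis :: (real ^ 'n) set)"
    using finite_same_card_bij[of "{1..CARD('n)}" "Basis :: (real ^ 'n) set"] by auto
  define T where "T = (\<lambda>x. \<Sum>i\<in>{1..CARD('n)}. (x \<bullet> \<beta> i) *\<^sub>R u i)"
  have "orthogonal_transformation T"
    unfolding orthogonal_transformation_def
  proof (intro conjI allI)
    show "linear T"
      unfolding T_def
      by (intro linearI) (simp_all add: inner_add_left scaleR_add_left sum.distrib scaleR_sum_right)
    fix x y
    have "T x \<bullet> T y = (\<Sum>i\<in>{1..CARD('n)}. \<Sum>j\<in>{1..CARD('n)}. (x \<bullet> \<beta> i) * (y \<bullet> \<beta> j) * (u i \<bullet> u j))"
      unfolding T_def inner_sum_left unfolding inner_sum_right by (simp add: mult_ac)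
    also have "\<dots> = (\<Sum>i\<in>{1..CARD('n)}. \<Sum>j\<in>{1..CARD('n)}. if i = j then (x \<bullet> \<beta> i) * (y \<bullet> \<beta> j) else 0)"
      using assms unfolding orthonormal_frame_def by (intro sum.cong refl) auto
    also have "\<dots> = (\<Sum>i\<in>{1..CARD('n)}. (x \<bullet> \<beta> i) * (y \<bullet> \<beta> i))"
      by (simp add: sum.delta)
    also have "\<dots> = (\<Sum>b\<in>Basis. (x \<bullet> b) * (y \<bullet> b))"
      using sum.reindex_bij_betw[OF \<beta>, of "\<lambda>b. (x \<bullet> b) * (y \<bullet> b)"] by simp
    also have "\<dots> = x \<bullet> y" by (rule euclidean_inner[symmetric])
    finally show "T x \<bullet> T y = x \<bullet> y" .
  qed
  then show thesis using that \<beta> T_def by blast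
qed

lemma inner_orthonormal_frame_sum:
  fixes u :: "nat \<Rightarrow> real ^ 'n"
  assumes "orthonormal_frame u" "i \<in> {1..CARD('n)}"
  shows "(\<Sum>j\<in>{1..CARD('n)}. c j *\<^sub>R u j) \<bullet> u i = c i"
proof -
  have "(\<Sum>j\<in>{1..CARD('n)}. c j *\<^sub>R u j) \<bullet> u i = (\<Sum>j\<in>{1..CARD('n)}. if j = i then c j else 0)"
    unfolding inner_sum_left
    using assms unfolding orthonormal_frame_def by (intro sum.cong refl) auto
  also have "\<dots> = c i" using assms(2) by simp
  finally show ?thesis .
qed

lemma norm_orthonormal_frame_sum:
  fixes u :: "nat \<Rightarrow> real ^ 'n"
  assumes "orthonormal_frame u"
  shows "(norm (\<Sum>j\<in>{1..CARD('n)}. c j *\<^sub>R u j))\<^sup>2 = (\<Sum>j\<in>{1..CARD('n)}. (c j)\<^sup>2)"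
proof -
  have "(norm (\<Sum>j\<in>{1..CARD('n)}. c j *\<^sub>R u j))\<^sup>2
      = (\<Sum>i\<in>{1..CARD('n)}. ((\<Sum>j\<in>{1..CARD('n)}. c j *\<^sub>R u j) \<bullet> u i) * c i)"
    unfolding power2_norm_eq_inner inner_sum_right[of _ _ "{1..CARD('n)}"] by (simp add: mult.commute)
  also have "\<dots> = (\<Sum>i\<in>{1..CARD('n)}. (c i)\<^sup>2)"
    by (intro sum.cong refl) (simp only: inner_orthonormal_frame_sum[OF assms] power2_eq_square)
  finally show ?thesis .
qed

lemma nn_integral_lborel_translate:
  fixes f :: "'a::euclidean_space \<Rightarrow> ennreal"
  assumes "f \<in> borel_measurable borel"
  shows "(\<integral>\<^sup>+ x. f (c + x) \<partial>lborel) = (\<integral>\<^sup>+ x. f x \<partial>lborel)"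
proof -
  have "(+) c \<in> lborel \<rightarrow>\<^sub>M borel" "f \<in> borel_measurable (distr lborel borel ((+) c))"
    using assms by auto
  from nn_integral_distr[OF this] show ?thesis by (simp only: lborel_distr_plus)
qed

text \<open>This is the uniqueness of Haar measure in a special case. Let \<open>f\<close> and \<open>g\<close> be the indicator functions of
  \<open>A\<close> and of the unit ball. Translating by \<open>y\<close> and exchanging the integrals,
  \<open>(\<integral>f(T x) dx) * (\<integral>g(y) dy) = \<integral>\<integral> g(y) * f(y + T x) dx dy = \<integral>\<integral> g(y - T x) * f(y) dx dy\<close>, and the inner integral
  is \<open>f(y)\<close> times the volume of a unit ball because \<open>T\<close> is an isometry.\<close>

lemma distr_lborel_orthogonal_transformation:
  fixes T :: "'a::euclidean_space \<Rightarrow> 'a"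
  assumes "orthogonal_transformation T"
  shows "distr lborel borel T = lborel"
proof (rule measure_eqI)
  fix A assume "A \<in> sets (distr lborel borel T)"
  then have [measurable]: "A \<in> sets borel" by simp
  have lin: "linear T" using assms by (rule orthogonal_transformation_linear)
  have [measurable]: "T \<in> borel_measurable borel"
    by (intro borel_measurable_continuous_onI linear_continuous_on
        linear_conv_bounded_linear[THEN iffD1] lin)
  have surj: "\<exists>x. y = T x" for y
    using orthogonal_transformation_surj[OF assms] by (auto simp: surj_def)
  let ?f = "indicator A :: 'a \<Rightarrow> ennreal" and ?g = "indicator (ball 0 1) :: 'a \<Rightarrow> ennreal"
  let ?V = "emeasure lborel (ball (0::'a) 1)"
  have [measurable]: "ball (0::'a) 1 \<in> sets borel" by simp
  have g: "?g \<in> borel_measurable borel" by (intro borel_measurable_indicator) simp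
  have "(\<integral>\<^sup>+ x. ?f (T x) \<partial>lborel) * ?V = (\<integral>\<^sup>+ y. ?g y * (\<integral>\<^sup>+ x. ?f (T x) \<partial>lborel) \<partial>lborel)"
    using g by (subst nn_integral_multc) (auto simp: mult.commute)
  also have "\<dots> = (\<integral>\<^sup>+ y. (\<integral>\<^sup>+ x. ?g y * ?f (y + T x) \<partial>lborel) \<partial>lborel)"
  proof (rule nn_integral_cong)
    fix y
    obtain z where z: "y = T z" using surj by blast
    have "(\<integral>\<^sup>+ x. ?f (T x) \<partial>lborel) = (\<integral>\<^sup>+ x. ?f (T (z + x)) \<partial>lborel)"
      by (intro nn_integral_lborel_translate[symmetric]) measurable
    then show "?g y * (\<integral>\<^sup>+ x. ?f (T x) \<partial>lborel) = (\<integral>\<^sup>+ x. ?g y * ?f (y + T x) \<partial>lborel)"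
      by (subst nn_integral_cmult) (auto simp: z linear_add[OF lin])
  qed
  also have "\<dots> = (\<integral>\<^sup>+ x. (\<integral>\<^sup>+ y. ?g y * ?f (y + T x) \<partial>lborel) \<partial>lborel)"
    by (intro lborel_pair.Fubini') measurable
  also have "\<dots> = (\<integral>\<^sup>+ x. (\<integral>\<^sup>+ y. ?g (y - T x) * ?f y \<partial>lborel) \<partial>lborel)"
  proof (rule nn_integral_cong)
    fix x
    show "(\<integral>\<^sup>+ y. ?g y * ?f (y + T x) \<partial>lborel) = (\<integral>\<^sup>+ y. ?g (y - T x) * ?f y \<partial>lborel)"
      using nn_integral_lborel_translate[of "\<lambda>y. ?g (y - T x) * ?f y" "T x"] by (simp add: add.commute)
  qed
  also have "\<dots> = (\<integral>\<^sup>+ y. (\<integral>\<^sup>+ x. ?g (y - T x) * ?f y \<partial>lborel) \<partial>lborel)"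
    by (intro lborel_pair.Fubini') measurable
  also have "\<dots> = (\<integral>\<^sup>+ y. ?V * ?f y \<partial>lborel)"
  proof (rule nn_integral_cong)
    fix y
    obtain z where z: "y = T z" using surj by blast
    have "?g (y - T x) = indicator (ball z 1) x" for x
      unfolding z linear_diff[OF lin, symmetric]
      using orthogonal_transformation_norm[OF assms, of "z - x"] by (auto simp: indicator_def dist_norm)
    then have "(\<integral>\<^sup>+ x. ?g (y - T x) \<partial>lborel) = emeasure lborel (ball z 1)" by simp
    also have "\<dots> = ?V"
      using emeasure_lborel_ball_finite[of z 1] emeasure_lborel_ball_finite[of "0::'a" 1]
      by (simp add: emeasure_eq_ennreal_measure less_top content_ball_conv_unit_ball[of 1 z])
    finally show "(\<integral>\<^sup>+ x. ?g (y - T x) * ?f y \<partial>lborel) = ?V * ?f y"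
      by (subst nn_integral_multc) auto
  qed
  also have "\<dots> = emeasure lborel A * ?V"
    by (subst nn_integral_cmult) (auto simp: mult.commute)
  also have "(\<integral>\<^sup>+ x. ?f (T x) \<partial>lborel) = emeasure (distr lborel borel T) A"
    using nn_integral_distr[of T lborel borel ?f] by simp
  finally have "emeasure (distr lborel borel T) A * ?V = emeasure lborel A * ?V" .
  moreover have "?V \<noteq> 0" "?V \<noteq> top"
    using emeasure_lborel_ball_finite[of "0::'a" 1] content_ball_pos[of 1 "0::'a"]
    by (auto simp: measure_def)
  ultimately show "emeasure (distr lborel borel T) A = emeasure lborel A"
    by (metis ennreal_mult_cancel_left mult.commute)
qed simp

lemma distr_PiM_lborel_reindex:
  fixes \<beta> :: "'k \<Rightarrow> 'i"
  assumes "bij_betw \<beta> K I" "finite K"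
  shows "distr (PiM K (\<lambda>_. lborel)) (PiM I (\<lambda>_. lborel :: real measure)) (\<lambda>f. \<lambda>b\<in>I. f (the_inv_into K \<beta> b))
    = PiM I (\<lambda>_. lborel)"
proof (rule lborel_product.PiM_eqI)
  have inv: "the_inv_into K \<beta> b \<in> K" "\<beta> (the_inv_into K \<beta> b) = b" if "b \<in> I" for b
    using assms(1) that by (auto simp: bij_betw_def the_inv_into_into f_the_inv_into_f)
  have inv': "the_inv_into K \<beta> (\<beta> i) = i" "\<beta> i \<in> I" if "i \<in> K" for i
    using assms(1) that by (auto simp: bij_betw_def the_inv_into_f_f)
  have [measurable]: "(\<lambda>f. \<lambda>b\<in>I. f (the_inv_into K \<beta> b)) \<in> PiM K (\<lambda>_. lborel) \<rightarrow>\<^sub>M PiM I (\<lambda>_. lborel :: real measure)"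
    by (rule measurable_restrict) (use inv in measurable)
  show "finite I" using assms bij_betw_finite by blast
  fix A :: "'i \<Rightarrow> real set" assume A: "\<And>i. i \<in> I \<Longrightarrow> A i \<in> sets lborel"
  have "(\<lambda>f. \<lambda>b\<in>I. f (the_inv_into K \<beta> b)) -` Pi\<^sub>E I A \<inter> space (PiM K (\<lambda>_. lborel :: real measure)) = (\<Pi>\<^sub>E i\<in>K. A (\<beta> i))"
  proof (rule set_eqI)
    fix f :: "'k \<Rightarrow> real"
    have "(\<forall>b\<in>I. f (the_inv_into K \<beta> b) \<in> A b) \<longleftrightarrow> (\<forall>i\<in>K. f i \<in> A (\<beta> i))"
      using inv inv' by metis
    then show "f \<in> (\<lambda>f. \<lambda>b\<in>I. f (the_inv_into K \<beta> b)) -` Pi\<^sub>E I A \<inter> space (PiM K (\<lambda>_. lborel :: real measure))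
        \<longleftrightarrow> f \<in> (\<Pi>\<^sub>E i\<in>K. A (\<beta> i))"
      by (simp add: space_PiM PiE_iff)
  qed
  then have "emeasure (distr (PiM K (\<lambda>_. lborel)) (PiM I (\<lambda>_. lborel :: real measure)) (\<lambda>f. \<lambda>b\<in>I. f (the_inv_into K \<beta> b))) (Pi\<^sub>E I A)
     = emeasure (PiM K (\<lambda>_. lborel)) (\<Pi>\<^sub>E i\<in>K. A (\<beta> i))"
    using A \<open>finite I\<close> by (subst emeasure_distr) (auto intro!: sets_PiM_I_finite)
  also have "\<dots> = (\<Prod>i\<in>K. emeasure lborel (A (\<beta> i)))"
    using A inv' assms by (intro lborel_product.emeasure_PiM) auto
  also have "\<dots> = (\<Prod>b\<in>I. emeasure lborel (A b))"
    using prod.reindex_bij_betw[OF assms(1)] by fast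
  finally show "emeasure (distr (PiM K (\<lambda>_. lborel)) (PiM I (\<lambda>_. lborel :: real measure)) (\<lambda>f. \<lambda>b\<in>I. f (the_inv_into K \<beta> b))) (Pi\<^sub>E I A)
     = (\<Prod>b\<in>I. emeasure lborel (A b))" .
qed simp

text \<open>Coordinates with respect to any orthonormal frame may be used to compute volumes.\<close>

lemma lborel_eq_distr_orthonormal_frame:
  fixes u :: "nat \<Rightarrow> real ^ 'n"
  assumes "orthonormal_frame u"
  shows "lborel = distr (PiM {1..CARD('n)} (\<lambda>_. lborel)) borel (\<lambda>f. \<Sum>i\<in>{1..CARD('n)}. f i *\<^sub>R u i)"
proof -
  let ?K = "{1..CARD('n)}"
  let ?PK = "PiM ?K (\<lambda>_. lborel :: real measure)"
  let ?PB = "PiM (Basis :: (real ^ 'n) set) (\<lambda>_. lborel :: real measure)"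
  obtain T \<beta> where T: "orthogonal_transformation T"
    and \<beta>: "bij_betw \<beta> ?K (Basis :: (real ^ 'n) set)"
    and eq: "\<And>x. T x = (\<Sum>i\<in>?K. (x \<bullet> \<beta> i) *\<^sub>R u i)"
    by (rule orthonormal_frame_transformation[OF assms]) blast
  let ?r = "\<lambda>f. \<lambda>b\<in>Basis. f (the_inv_into ?K \<beta> b)"
  let ?s = "\<lambda>f. \<Sum>b\<in>Basis. f b *\<^sub>R b :: real ^ 'n"
  have inv: "the_inv_into ?K \<beta> b \<in> ?K" if "b \<in> Basis" for b
    using \<beta> that by (metis bij_betw_def the_inv_into_into subset_refl)
  have r: "?r \<in> ?PK \<rightarrow>\<^sub>M ?PB"
    by (rule measurable_restrict) (use inv in measurable)
  have s: "?s \<in> ?PB \<rightarrow>\<^sub>M borel" by measurable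
  have Tm: "T \<in> borel_measurable borel"
    by (intro borel_measurable_continuous_onI linear_continuous_on
        linear_conv_bounded_linear[THEN iffD1] orthogonal_transformation_linear T)
  have "lborel = distr (distr (distr ?PK ?PB ?r) borel ?s) borel T"
    using distr_PiM_lborel_reindex[OF \<beta>] distr_lborel_orthogonal_transformation[OF T]
    by (simp add: lborel_eq[symmetric])
  also have "\<dots> = distr ?PK borel (T \<circ> (?s \<circ> ?r))"
    using r s Tm by (simp add: distr_distr measurable_comp)
  also have "T \<circ> (?s \<circ> ?r) = (\<lambda>f. \<Sum>i\<in>?K. f i *\<^sub>R u i)"
  proof
    fix f
    have "?s (?r f) \<bullet> \<beta> i = f i" if "i \<in> ?K" for i
    proof -
      have "\<beta> i \<in> Basis" "the_inv_into ?K \<beta> (\<beta> i) = i"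
        using \<beta> that by (auto simp: bij_betw_def the_inv_into_f_f)
      then show ?thesis by simp
    qed
    then show "(T \<circ> (?s \<circ> ?r)) f = (\<Sum>i\<in>?K. f i *\<^sub>R u i)" by (simp add: eq)
  qed
  finally show ?thesis .
qed

lemma emeasure_rotated_box_shell:
  fixes u :: "nat \<Rightarrow> real ^ 'n"
  assumes "orthonormal_frame u"
  shows "emeasure lborel {y. (\<forall>i\<in>{1..CARD('n)}. \<bar>(y - a) \<bullet> u i\<bar> \<le> L i) \<and> \<sigma> \<le> (norm y)\<^sup>2 \<and> (norm y)\<^sup>2 \<le> \<sigma> + w}
    = emeasure (PiM {1..CARD('n)} (\<lambda>_. lborel)) (box_shell {1..CARD('n)} (\<lambda>i. a \<bullet> u i) L \<sigma> w)" (is "emeasure lborel ?G = _")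
proof -
  let ?P = "PiM {1..CARD('n)} (\<lambda>_. lborel :: real measure)"
  let ?s = "\<lambda>f. \<Sum>i\<in>{1..CARD('n)}. f i *\<^sub>R u i"
  have "?G = (\<Inter>i\<in>{1..CARD('n)}. {y. \<bar>(y - a) \<bullet> u i\<bar> \<le> L i}) \<inter> {y. \<sigma> \<le> (norm y)\<^sup>2 \<and> (norm y)\<^sup>2 \<le> \<sigma> + w}"
    by auto
  also have "closed \<dots>"
    by (intro closed_Int closed_INT ballI closed_Collect_conj closed_Collect_le continuous_intros)
  finally have "closed ?G" .
  then have G: "?G \<in> sets borel" by auto
  have "emeasure lborel ?G = emeasure (distr ?P borel ?s) ?G"
    using lborel_eq_distr_orthonormal_frame[OF assms] by simp
  also have "\<dots> = emeasure ?P (?s -` ?G \<inter> space ?P)"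
    using G by (intro emeasure_distr) measurable
  also have "?s -` ?G \<inter> space ?P = box_shell {1..CARD('n)} (\<lambda>i. a \<bullet> u i) L \<sigma> w"
    using inner_orthonormal_frame_sum[OF assms] norm_orthonormal_frame_sum[OF assms]
    by (auto simp: box_shell_def inner_diff_left)
  finally show ?thesis .
qed

section \<open>Volume of a box inside a thin shell\<close>

lemma Delta_pos: "\<delta> \<in> Delta n \<Longrightarrow> i \<in> {1..n} \<Longrightarrow> 0 < \<delta> i"
  and Delta_less_1: "\<delta> \<in> Delta n \<Longrightarrow> i \<in> {1..n} \<Longrightarrow> \<delta> i < 1"
  by (auto simp: Delta_def)

lemma Delta_antimono: "\<delta> \<in> Delta n \<Longrightarrow> 1 \<le> i \<Longrightarrow> i \<le> j \<Longrightarrow> j \<le> n \<Longrightarrow> \<delta> j \<le> \<delta> i"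
  by (auto simp: Delta_def intro: monotone_onD)

lemma Gamma_box_pos:
  assumes "\<delta> \<in> Delta (m + 1)"
  shows "Gamma_box m \<delta> > 0"
proof -
  have pos: "\<delta> i > 0" if "i \<in> {1..m+1}" for i using Delta_pos[OF assms that] .
  then have "\<delta> (m+1) > 0" by simp
  with pos show ?thesis unfolding Gamma_box_def by (auto simp: less_imp_neq[symmetric] intro!: prod_pos mult_pos_pos)
qed

text \<open>The width \<open>w\<close> is at most of the order of \<open>\<delta> k\<close>, the side of the removed coordinate. Each of the three terms of
  \<open>Gamma_box\<close> is matched with one of three ways of using the shell: not at all, to confine coordinate
  \<open>1\<close>, or to confine coordinates \<open>1\<close> and \<open>2\<close>. If the coordinate to be confined has itself been removed,
  dropping the shell is enough, because the product then still contains the small factor \<open>\<delta> (m + 1)\<close>.\<close>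

lemma emeasure_box_shell_le_Gamma_box:
  fixes \<delta> \<alpha> :: "nat \<Rightarrow> real"
  assumes m: "m \<ge> 2" and \<delta>: "\<delta> \<in> Delta (m + 1)" and k: "k \<in> {1..m + 1}"
    and w: "0 \<le> w" "w \<le> 15 * \<delta> k"
  shows "emeasure (PiM ({1..m + 1} - {k}) (\<lambda>_. lborel)) (box_shell ({1..m + 1} - {k}) \<alpha> \<delta> \<sigma> w)
    \<le> ennreal (2 ^ m * (8 + 15 * measure lborel (ball (0::real \<times> real) 1)) * Gamma_box m \<delta>)"
proof -
  let ?V = "measure lborel (ball (0::real \<times> real) 1)"
  let ?M = "2 ^ m * (8 + 15 * ?V)"
  let ?\<mu> = "emeasure (PiM ({1..m + 1} - {k}) (\<lambda>_. lborel)) (box_shell ({1..m + 1} - {k}) \<alpha> \<delta> \<sigma> w)"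
  define d where "d = \<delta> (m + 1)"
  define A where "A = (\<Prod>i=1..m. \<delta> i)"
  define B where "B = (\<Prod>i=2..m. \<delta> i)"
  define C where "C = (\<Prod>i=3..m. \<delta> i)"
  have V: "?V \<ge> 0" by simp
  have pos: "\<delta> i > 0" if "i \<in> {1..m+1}" for i using Delta_pos[OF \<delta> that] .
  have lt1: "\<delta> i < 1" if "i \<in> {1..m+1}" for i using Delta_less_1[OF \<delta> that] .
  have d: "0 < d" "d < 1" "d \<le> \<delta> k" using pos lt1 k Delta_antimono[OF \<delta>, of k "m+1"] by (auto simp: d_def)
  have ABC: "A > 0" "B > 0" "C > 0"
    unfolding A_def B_def C_def by (auto intro!: prod_pos pos)
  have dk: "0 < \<delta> k" "\<delta> k < 1" using pos lt1 k by auto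
  have sq: "d / sqrt d = sqrt d" using d by (simp add: real_div_sqrt)
  \<comment> \<open>The sides of the box are \<open>2 * \<delta> i\<close>; their factors \<open>2\<close> are collected into \<open>2 ^ m\<close>.\<close>
  have le: "?\<mu> \<le> ennreal (?M * g)"
    if "?\<mu> \<le> ennreal (x * (\<Prod>i\<in>J. 2 * \<delta> i))" "x * (\<Prod>i\<in>J. \<delta> i) \<le> (8 + 15 * ?V) * g"
      "J \<subseteq> {1..m+1} - {k}" "x \<ge> 0" for J x g
  proof -
    have c: "card J \<le> m"
      using card_mono[OF _ that(3)] k by simp
    have xJ: "(\<Prod>i\<in>J. \<delta> i) > 0"
      by (intro prod_pos ballI pos) (use that(3) in blast)
    have "x * (\<Prod>i\<in>J. 2 * \<delta> i) = 2 ^ card J * (x * (\<Prod>i\<in>J. \<delta> i))"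
      by (simp add: prod.distrib)
    also have "\<dots> \<le> 2 ^ m * ((8 + 15 * ?V) * g)"
    proof (rule mult_mono[OF _ that(2)])
      show "(2::real) ^ card J \<le> 2 ^ m" using c by simp
      show "0 \<le> x * (\<Prod>i\<in>J. \<delta> i)" using xJ that(4) by simp
    qed simp
    finally show ?thesis
      using that(1) by (auto simp: mult.assoc intro: order.trans ennreal_leI)
  qed
  have mu1: "?\<mu> \<le> ennreal (1 * (\<Prod>i\<in>{1..m+1} - {k}. 2 * \<delta> i))"
    using emeasure_box_shell_le[of "{1..m+1} - {k}" \<delta>] pos by (simp add: less_imp_le)
  have mu2: "?\<mu> \<le> ennreal (2 * sqrt w * (\<Prod>i\<in>{2..m+1} - {k}. 2 * \<delta> i))" if "k \<noteq> 1"
  proof -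
    have "{1..m+1} - {k} = insert 1 ({2..m+1} - {k})" using that by auto
    then show ?thesis
      using emeasure_box_shell_insert_le[of "{2..m+1} - {k}" 1 \<delta> w \<alpha> \<sigma>] pos w by (simp add: less_imp_le)
  qed
  have mu3: "?\<mu> \<le> ennreal (?V * w * (\<Prod>i\<in>{3..m+1} - {k}. 2 * \<delta> i))" if "k \<noteq> 1" "k \<noteq> 2"
  proof -
    have "{1..m+1} - {k} = insert 1 (insert 2 ({3..m+1} - {k}))" using that m by auto
    then show ?thesis
      using emeasure_box_shell_insert2_le[of "{3..m+1} - {k}" 1 2 \<delta> w \<alpha> \<sigma>] pos w by (simp add: less_imp_le)
  qed
  have p1: "(\<Prod>i\<in>{1..m+1}. \<delta> i) = A * d" and p2: "(\<Prod>i\<in>{2..m+1}. \<delta> i) = B * d"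
    and p3: "(\<Prod>i\<in>{3..m+1}. \<delta> i) = C * d"
    using m unfolding A_def B_def C_def d_def by (simp_all add: mult.commute)
  have rm: "(\<Prod>i\<in>J. \<delta> i) = \<delta> k * (\<Prod>i\<in>J - {k}. \<delta> i)" if "k \<in> J" "finite J" for J
    using that by (simp add: prod.remove)
  have AB: "A = \<delta> 1 * B" "B = \<delta> 2 * C"
    unfolding A_def B_def C_def using m
    by (simp_all add: prod.atLeast_Suc_atMost numeral_2_eq_2 numeral_3_eq_3)
  have goalA: "?\<mu> \<le> ennreal (?M * A)"
  proof (rule le[OF mu1])
    have "(\<Prod>i\<in>{1..m+1} - {k}. \<delta> i) = A * d / \<delta> k"
      using rm[OF k] p1 dk by (simp add: field_simps)
    also have "\<dots> \<le> A" using d dk ABC by (simp add: divide_le_eq)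
    also have "\<dots> \<le> (8 + 15 * ?V) * A" using ABC V by (simp add: distrib_right add_increasing2)
    finally show "1 * (\<Prod>i\<in>{1..m+1} - {k}. \<delta> i) \<le> (8 + 15 * ?V) * A" by simp
  qed (use w in auto)
  have sd: "d \<le> sqrt d" using d by (intro real_le_rsqrt) (auto simp: power2_eq_square mult_le_cancel_left1)
  have goalB: "?\<mu> \<le> ennreal (?M * (sqrt d * B))"
  proof (cases "k = 1")
    case True
    show ?thesis
    proof (rule le[OF mu1])
      have "{1..m+1} - {k} = {2..m+1}" using True by auto
      then have "(\<Prod>i\<in>{1..m+1} - {k}. \<delta> i) = d * B" using p2 by (simp add: mult.commute)
      also have "\<dots> \<le> sqrt d * B" using sd ABC by simp
      also have "\<dots> \<le> (8 + 15 * ?V) * (sqrt d * B)" using ABC V d by (simp add: distrib_right add_increasing2)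
      finally show "1 * (\<Prod>i\<in>{1..m+1} - {k}. \<delta> i) \<le> (8 + 15 * ?V) * (sqrt d * B)" by simp
    qed (use w in auto)
  next
    case False
    show ?thesis
    proof (rule le[OF mu2[OF False]])
      have k2: "k \<in> {2..m+1}" using k False by auto
      have "sqrt w \<le> sqrt (16 * \<delta> k)" using w dk by simp
      also have "\<dots> = 4 * sqrt (\<delta> k)" by (simp add: real_sqrt_mult)
      finally have sw: "2 * sqrt w \<le> 8 * sqrt (\<delta> k)" by simp
      have eq: "(\<Prod>i\<in>{2..m+1} - {k}. \<delta> i) = B * d / \<delta> k"
        using rm[OF k2] p2 dk by (simp add: field_simps)
      have "2 * sqrt w * (\<Prod>i\<in>{2..m+1} - {k}. \<delta> i) \<le> 8 * sqrt (\<delta> k) * (B * d / \<delta> k)"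
        unfolding eq using sw ABC d dk by (intro mult_right_mono) auto
      also have "\<dots> = 8 * B * (d / sqrt (\<delta> k))"
        using dk by (simp add: field_simps)
      also have "\<dots> \<le> 8 * B * (d / sqrt d)"
        using ABC d dk by (intro mult_left_mono divide_left_mono) auto
      also have "\<dots> = 8 * (sqrt d * B)" using sq by simp
      also have "\<dots> \<le> (8 + 15 * ?V) * (sqrt d * B)"
        using V ABC d by (intro mult_right_mono) auto
      finally show "2 * sqrt w * (\<Prod>i\<in>{2..m+1} - {k}. \<delta> i) \<le> (8 + 15 * ?V) * (sqrt d * B)" .
    qed (use w in auto)
  qed
  have goalC: "?\<mu> \<le> ennreal (?M * (d * C))"
  proof (cases "k = 1 \<or> k = 2")
    case True
    show ?thesis
    proof (rule le[OF mu1])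
      have "(\<Prod>i\<in>{1..m+1} - {k}. \<delta> i) = A * d / \<delta> k"
        using rm[OF k] p1 dk by (simp add: field_simps)
      also have "\<dots> \<le> d * C"
        using True lt1[of 1] lt1[of 2] pos[of 1] pos[of 2] m ABC d unfolding AB
        by (auto simp: mult_le_cancel_right1 mult_le_cancel_left1)
      also have "\<dots> \<le> (8 + 15 * ?V) * (d * C)" using ABC V d by (simp add: distrib_right add_increasing2)
      finally show "1 * (\<Prod>i\<in>{1..m+1} - {k}. \<delta> i) \<le> (8 + 15 * ?V) * (d * C)" by simp
    qed (use w in auto)
  next
    case False
    then have "k \<noteq> 1" "k \<noteq> 2" by auto
    show ?thesis
    proof (rule le[OF mu3[OF \<open>k \<noteq> 1\<close> \<open>k \<noteq> 2\<close>]])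
      have k3: "k \<in> {3..m+1}" using k False by auto
      have eq: "(\<Prod>i\<in>{3..m+1} - {k}. \<delta> i) = C * d / \<delta> k"
        using rm[OF k3] p3 dk by (simp add: field_simps)
      have "?V * w * (\<Prod>i\<in>{3..m+1} - {k}. \<delta> i) \<le> ?V * (15 * \<delta> k) * (C * d / \<delta> k)"
        unfolding eq using w ABC d dk V by (intro mult_right_mono mult_left_mono) auto
      also have "\<dots> = 15 * ?V * (d * C)" using dk by (simp add: field_simps)
      also have "\<dots> \<le> (8 + 15 * ?V) * (d * C)"
        using V ABC d by (intro mult_right_mono) auto
      finally show "?V * w * (\<Prod>i\<in>{3..m+1} - {k}. \<delta> i) \<le> (8 + 15 * ?V) * (d * C)" .
    qed (use w in auto)
  qed
  have "Gamma_box m \<delta> \<in> {A, sqrt d * B, d * C}"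
  proof -
    have "Gamma_box m \<delta> = Min {A, sqrt d * B, d * C}"
      using d unfolding Gamma_box_def A_def B_def C_def d_def by (simp add: powr_half_sqrt)
    also have "\<dots> \<in> {A, sqrt d * B, d * C}" by (rule Min_in) auto
    finally show ?thesis .
  qed
  then show ?thesis using goalA goalB goalC by auto
qed

text \<open>A point of the shell has a coordinate of modulus at least \<open>1 / sqrt (m + 1)\<close>. The bound on \<open>\<delta> 1\<close>
  keeps this coordinate at half that size throughout the box.\<close>

lemma measure_rotated_box_inter_shell_le:
  fixes u :: "nat \<Rightarrow> real ^ 'n"
  assumes m: "m \<ge> 2" "CARD('n) = m + 1" and \<delta>: "\<delta> \<in> Delta (m + 1)"
    and u: "orthonormal_frame u" and small: "\<delta> 1 \<le> 1 / (4 * sqrt (real (m + 1)))"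
  shows "emeasure lborel {y. (\<forall>i\<in>{1..m+1}. \<bar>(y - a) \<bullet> u i\<bar> \<le> \<delta> i) \<and> 1 \<le> (norm y)\<^sup>2 \<and> (norm y)\<^sup>2 \<le> 1 + \<delta> (m + 1)}
    \<le> ennreal (4 * sqrt (real (m + 1)) * \<delta> (m + 1) * (2 ^ m * (8 + 15 * measure lborel (ball (0::real \<times> real) 1)) * Gamma_box m \<delta>))"
    (is "emeasure lborel ?G \<le> ennreal (?c * ?M)")
proof -
  let ?I = "{1..m+1}"
  let ?\<alpha> = "\<lambda>i. a \<bullet> u i"
  define d where "d = \<delta> (m+1)"
  define s where "s = sqrt (real (m + 1))"
  have s: "s > 0" by (simp add: s_def)
  have pos: "\<delta> i > 0" if "i \<in> ?I" for i using Delta_pos[OF \<delta> that] .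
  have lt1: "\<delta> i < 1" if "i \<in> ?I" for i using Delta_less_1[OF \<delta> that] .
  have d: "0 < d" "d < 1" using pos lt1 by (auto simp: d_def)
  let ?E = "box_shell ?I ?\<alpha> \<delta> 1 d"
  have eq: "emeasure lborel ?G = emeasure (PiM ?I (\<lambda>_. lborel)) ?E"
    using emeasure_rotated_box_shell[OF u, of a \<delta> 1 d] by (simp add: m d_def)
  show ?thesis
  proof (cases "?E = {}")
    case True
    then show ?thesis unfolding eq by simp
  next
    case False
    then obtain f where f: "f \<in> ?E" by blast
    have "\<exists>k\<in>?I. 1 / (m + 1) \<le> (f k)\<^sup>2"
    proof (rule ccontr)
      assume "\<not> ?thesis"
      then have "(\<Sum>k\<in>?I. (f k)\<^sup>2) < (\<Sum>k\<in>?I. 1 / (m + 1))"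
        by (intro sum_strict_mono) (auto simp: not_le)
      also have "\<dots> = 1" by simp
      finally show False using f by (simp add: box_shell_def)
    qed
    then obtain k where k: "k \<in> ?I" "1 / (m + 1) \<le> (f k)\<^sup>2" by blast
    have "sqrt (1 / (m+1)) \<le> sqrt ((f k)\<^sup>2)" using k(2) real_sqrt_le_mono by blast
    then have fk: "1 / s \<le> \<bar>f k\<bar>" by (simp add: s_def real_sqrt_divide)
    have "(f k)\<^sup>2 \<le> (\<Sum>k\<in>?I. (f k)\<^sup>2)" using k(1) by (intro member_le_sum) auto
    also have "\<dots> \<le> 2\<^sup>2" using f d by (simp add: box_shell_def)
    finally have fk2: "\<bar>f k\<bar> \<le> 2" using abs_le_square_iff[of "f k" 2] by simp
    have f\<alpha>: "\<bar>f k - ?\<alpha> k\<bar> \<le> \<delta> k" using f k by (simp add: box_shell_def)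
    have "\<delta> k \<le> 1 / (4 * s)" using Delta_antimono[OF \<delta>, of 1 k] k small by (simp add: s_def)
    then have k4: "\<delta> k \<le> 1 / s / 4" by simp
    define e where "e = \<delta> k * (2 * \<bar>?\<alpha> k\<bar> + \<delta> k)"
    have dk: "0 < \<delta> k" "\<delta> k < 1" using pos lt1 k by auto
    have "e \<le> \<delta> k * 7" unfolding e_def using dk f\<alpha> fk2 by (intro mult_left_mono) auto
    moreover have "d \<le> \<delta> k" using Delta_antimono[OF \<delta>, of k "m+1"] k by (simp add: d_def)
    ultimately have w: "d + 2 * e \<le> 15 * \<delta> k" by linarith
    have e0: "e \<ge> 0" unfolding e_def using dk by simp
    have ins: "insert k (?I - {k}) = ?I" using k by auto
    have q: "1 / s / 2 \<le> \<bar>?\<alpha> k\<bar> - \<delta> k" "0 < 1 / s / 2" using f\<alpha> fk k4 s by auto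
    have "emeasure (PiM ?I (\<lambda>_. lborel)) ?E \<le> ennreal (2 * d / (1 / s / 2)) *
        emeasure (PiM (?I - {k}) (\<lambda>_. lborel)) (box_shell (?I - {k}) ?\<alpha> \<delta> (1 - (?\<alpha> k)\<^sup>2 - e) (d + 2 * e))"
      using emeasure_box_shell_remove_le[of "?I - {k}" k d "1 / s / 2" \<delta> ?\<alpha> 1] d dk q
      unfolding ins e_def by auto
    also have "\<dots> \<le> ennreal (2 * d / (1 / s / 2)) * ennreal ?M"
      using emeasure_box_shell_le_Gamma_box[OF m(1) \<delta> k(1) _ w] d e0 by (intro mult_left_mono) auto
    also have "\<dots> = ennreal (?c * ?M)"
      using d s by (subst ennreal_mult'[symmetric]) (auto simp: s_def d_def mult_ac)
    finally show ?thesis using eq by simp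
  qed
qed

section \<open>The lower bound\<close>

lemma measure_spherical_shell_ge:
  fixes w :: real
  assumes "w \<ge> 0" "DIM('a::euclidean_space) \<ge> 2"
  shows "ennreal (measure lborel (ball (0::'a) 1) * w)
    \<le> emeasure lborel {y::'a. 1 \<le> (norm y)\<^sup>2 \<and> (norm y)\<^sup>2 \<le> 1 + w}"
proof -
  let ?V = "measure lborel (ball (0::'a) 1)"
  define r where "r = sqrt (1 + w)"
  have r: "r \<ge> 1" "r\<^sup>2 = 1 + w" using assms by (auto simp: r_def)
  have "1 + w \<le> r ^ DIM('a)"
    using power_increasing[OF assms(2) r(1)] r(2) by simp
  then have "?V * w \<le> ?V * r ^ DIM('a) - ?V"
    using mult_left_mono[of "1 + w" "r ^ DIM('a)" ?V] by (simp add: algebra_simps)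
  also have "\<dots> = measure lborel (cball (0::'a) r) - measure lborel (ball (0::'a) 1)"
    using r by (simp add: content_cball_conv_ball content_ball_conv_unit_ball[of r])
  finally have "ennreal (?V * w) \<le> ennreal (measure lborel (cball (0::'a) r) - measure lborel (ball (0::'a) 1))"
    by (rule ennreal_leI)
  also have "\<dots> = emeasure lborel (cball (0::'a) r) - emeasure lborel (ball (0::'a) 1)"
    using emeasure_lborel_ball_finite[of "0::'a" 1] emeasure_lborel_cball_finite[of "0::'a" r]
    by (simp add: ennreal_minus[symmetric] emeasure_eq_ennreal_measure less_top)
  also have "\<dots> = emeasure lborel (cball (0::'a) r - ball 0 1)"
    using emeasure_lborel_ball_finite[of "0::'a" 1] r
    by (intro emeasure_Diff[symmetric]) (auto intro: less_imp_le order.trans)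
  also have "\<dots> \<le> emeasure lborel {y::'a. 1 \<le> (norm y)\<^sup>2 \<and> (norm y)\<^sup>2 \<le> 1 + w}"
  proof (rule emeasure_mono)
    show "cball (0::'a) r - ball 0 1 \<subseteq> {y. 1 \<le> (norm y)\<^sup>2 \<and> (norm y)\<^sup>2 \<le> 1 + w}"
    proof
      fix y :: 'a assume "y \<in> cball 0 r - ball 0 1"
      then have y: "1 \<le> norm y" "norm y \<le> r" by auto
      then show "y \<in> {y. 1 \<le> (norm y)\<^sup>2 \<and> (norm y)\<^sup>2 \<le> 1 + w}"
        using power_mono[OF y(1), of 2] power_mono[OF y(2), of 2] r by simp
    qed
    have "closed {y::'a. 1 \<le> (norm y)\<^sup>2 \<and> (norm y)\<^sup>2 \<le> 1 + w}"
      by (intro closed_Collect_conj closed_Collect_le continuous_intros)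
    then show "{y::'a. 1 \<le> (norm y)\<^sup>2 \<and> (norm y)\<^sup>2 \<le> 1 + w} \<in> sets lborel" by simp
  qed
  finally show ?thesis .
qed

text \<open>A box meeting the sphere at \<open>y / \<bar>y\<bar>\<close> need not contain the point \<open>y\<close> of the shell, but the two
  points are at distance at most \<open>d / 2\<close>, which is at most half of every side bound \<open>\<delta> i\<close>. Hence the half
  sides \<open>\<delta> i\<close> in the set \<open>?G\<close>.\<close>

lemma card_box_cover_sphere_ge:
  fixes \<B> :: "(real ^ 'n) set set"
  assumes m: "m \<ge> 2" "CARD('n) = m + 1" and \<delta>: "\<delta> \<in> Delta (m + 1)"
    and small: "\<delta> 1 \<le> 1 / (4 * sqrt (real (m + 1)))"
    and \<B>: "finite \<B>" "box_cover (sphere 0 1) \<delta> \<B>"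
  defines "K \<equiv> 4 * sqrt (real (m + 1)) * (2 ^ m * (8 + 15 * measure lborel (ball (0::real \<times> real) 1)))"
  shows "measure lborel (ball (0::real ^ 'n) 1) \<le> card \<B> * (K * Gamma_box m \<delta>)"
proof -
  define d where "d = \<delta> (m + 1)"
  have d: "0 < d" using Delta_pos[OF \<delta>, of "m+1"] by (simp add: d_def)
  let ?V = "measure lborel (ball (0::real ^ 'n) 1)"
  let ?T = "{y::real^'n. 1 \<le> (norm y)\<^sup>2 \<and> (norm y)\<^sup>2 \<le> 1 + d}"
  let ?G = "\<lambda>a u. {y::real^'n. (\<forall>i\<in>{1..m+1}. \<bar>(y - a) \<bullet> u i\<bar> \<le> \<delta> i) \<and> 1 \<le> (norm y)\<^sup>2 \<and> (norm y)\<^sup>2 \<le> 1 + d}"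
  define R where "R B a u \<longleftrightarrow> orthonormal_frame u \<and> (\<forall>y\<in>?T. y /\<^sub>R norm y \<in> B \<longrightarrow> y \<in> ?G a u)" for B a u
  have "\<exists>a u. R B a u" if "B \<in> \<B>" for B
  proof -
    obtain l where l: "open_box l B" "\<And>i. i \<in> {1..m+1} \<Longrightarrow> l i \<le> \<delta> i"
      using \<B>(2) \<open>B \<in> \<B>\<close> unfolding box_cover_def m(2) by blast
    then obtain a u where u: "orthonormal_frame u"
      and B: "B = {x. \<forall>i\<in>{1..m+1}. \<bar>(x - a) \<bullet> u i\<bar> < l i / 2}"
      using m(2) by (auto simp: open_box_def orthonormal_frame_def)
    have "y \<in> ?G a u" if y: "y \<in> ?T" and yB: "y /\<^sub>R norm y \<in> B" for y
    proof -
      have ny: "1 \<le> norm y" using y power2_le_imp_le[of 1 "norm y"] by simp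
      have "(norm y - 1) * 2 \<le> (norm y - 1) * (norm y + 1)" using ny by (intro mult_left_mono) auto
      also have "\<dots> \<le> d" using y by (simp add: algebra_simps power2_eq_square)
      finally have ny2: "norm y - 1 \<le> d / 2" by simp
      have "y - y /\<^sub>R norm y = (norm y - 1) *\<^sub>R (y /\<^sub>R norm y)"
      proof -
        have "norm y * inverse (norm y) = 1" using ny by (intro right_inverse) auto
        then show ?thesis by (simp add: algebra_simps)
      qed
      then have dist: "norm (y - y /\<^sub>R norm y) = norm y - 1"
        using ny by (simp only: norm_scaleR) (auto simp: divide_simps)
      have "\<bar>(y - a) \<bullet> u i\<bar> \<le> \<delta> i" if i: "i \<in> {1..m+1}" for i
      proof -
        have "norm (u i) = 1" using u i m(2) by (simp add: orthonormal_frame_def norm_eq_1)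
        then have "\<bar>(y - y /\<^sub>R norm y) \<bullet> u i\<bar> \<le> d / 2"
          using Cauchy_Schwarz_ineq2[of "y - y /\<^sub>R norm y" "u i"] ny2 dist by simp
        moreover have "\<bar>(y /\<^sub>R norm y - a) \<bullet> u i\<bar> < \<delta> i / 2"
        proof -
          have "\<bar>(y /\<^sub>R norm y - a) \<bullet> u i\<bar> < l i / 2" using yB i unfolding B by blast
          then show ?thesis using l(2)[OF i] by linarith
        qed
        moreover have "d \<le> \<delta> i" using Delta_antimono[OF \<delta>, of i "m+1"] i by (simp add: d_def)
        moreover have "(y - a) \<bullet> u i = (y - y /\<^sub>R norm y) \<bullet> u i + (y /\<^sub>R norm y - a) \<bullet> u i"
          by (simp add: inner_diff_left)
        ultimately show ?thesis by linarith
      qed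
      then show ?thesis using y by auto
    qed
    then show ?thesis using u unfolding R_def by blast
  qed
  then obtain a u where R: "\<And>B. B \<in> \<B> \<Longrightarrow> R B (a B) (u B)" by metis
  have au: "\<And>B. B \<in> \<B> \<Longrightarrow> orthonormal_frame (u B)"
    "\<And>B y. B \<in> \<B> \<Longrightarrow> y \<in> ?T \<Longrightarrow> y /\<^sub>R norm y \<in> B \<Longrightarrow> y \<in> ?G (a B) (u B)"
    using R unfolding R_def by blast+
  have meas: "?G a u \<in> sets lborel" for a u
  proof -
    have "?G a u = (\<Inter>i\<in>{1..m+1}. {y. \<bar>(y - a) \<bullet> u i\<bar> \<le> \<delta> i}) \<inter> ?T" by auto
    also have "closed \<dots>"
      by (intro closed_Int closed_INT ballI closed_Collect_conj closed_Collect_le continuous_intros)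
    finally show ?thesis by simp
  qed
  have sub: "?T \<subseteq> (\<Union>B\<in>\<B>. ?G (a B) (u B))"
  proof
    fix y assume y: "y \<in> ?T"
    then have "y \<noteq> 0" by auto
    then have "y /\<^sub>R norm y \<in> sphere 0 1" by simp
    then obtain B where "B \<in> \<B>" "y /\<^sub>R norm y \<in> B" using \<B>(2) unfolding box_cover_def by blast
    then show "y \<in> (\<Union>B\<in>\<B>. ?G (a B) (u B))" using au(2) y by blast
  qed
  have K: "K \<ge> 0" unfolding K_def by (intro mult_nonneg_nonneg) auto
  have \<Gamma>: "Gamma_box m \<delta> > 0" by (rule Gamma_box_pos[OF \<delta>])
  have "ennreal (?V * d) \<le> emeasure lborel ?T"
    using measure_spherical_shell_ge[of d, where 'a = "real ^ 'n"] d m by simp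
  also have "\<dots> \<le> emeasure lborel (\<Union>B\<in>\<B>. ?G (a B) (u B))"
    using sub meas \<B>(1) by (intro emeasure_mono sets.finite_UN) auto
  also have "\<dots> \<le> (\<Sum>B\<in>\<B>. emeasure lborel (?G (a B) (u B)))"
    using meas \<B>(1) by (intro emeasure_subadditive_finite) auto
  also have "\<dots> \<le> (\<Sum>B\<in>\<B>. ennreal (K * Gamma_box m \<delta> * d))"
  proof (rule sum_mono)
    fix B assume "B \<in> \<B>"
    then show "emeasure lborel (?G (a B) (u B)) \<le> ennreal (K * Gamma_box m \<delta> * d)"
      using measure_rotated_box_inter_shell_le[OF m \<delta> au(1) small, of B "a B"]
      by (simp add: d_def K_def mult_ac)
  qed
  also have "\<dots> = ennreal (card \<B> * (K * Gamma_box m \<delta>) * d)"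
    using K \<Gamma> d by (simp add: ennreal_mult' ennreal_of_nat_eq_real_of_nat mult.assoc)
  finally have "?V * d \<le> card \<B> * (K * Gamma_box m \<delta>) * d"
    using K \<Gamma> d by (subst (asm) ennreal_le_iff) auto
  then show ?thesis using d by simp
qed

section \<open>Nets on the sphere\<close>

lemma power_diff_le_real:
  fixes a b :: real
  assumes "0 \<le> b" "b \<le> a"
  shows "a ^ n - b ^ n \<le> n * (a - b) * a ^ (n - 1)"
proof (cases n)
  case (Suc k)
  have "a ^ Suc k - b ^ Suc k = (a - b) * (\<Sum>i<Suc k. a ^ i * b ^ (k - i))"
    by (rule diff_power_eq_sum)
  also have "\<dots> \<le> (a - b) * (\<Sum>i<Suc k. a ^ k)"
  proof (intro mult_left_mono sum_mono)
    fix i assume i: "i \<in> {..<Suc k}"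
    have "a ^ i * b ^ (k - i) \<le> a ^ i * a ^ (k - i)"
      using assms by (intro mult_left_mono power_mono) auto
    also have "\<dots> = a ^ k" using i by (simp flip: power_add)
    finally show "a ^ i * b ^ (k - i) \<le> a ^ k" .
  qed (use assms in auto)
  finally show ?thesis using Suc by (simp add: mult_ac)
qed simp

text \<open>Packing: the balls of radius \<open>h / 2\<close> around the points of \<open>P\<close> are disjoint and lie in a shell of
  thickness \<open>h\<close>, which explains the exponent one below the dimension.\<close>

lemma card_separated_subset_sphere_le:
  fixes P :: "'a::euclidean_space set" and h :: real
  assumes h: "0 < h" "h \<le> 1" and P: "finite P" "P \<subseteq> sphere 0 1"
    and sep: "\<And>p q. p \<in> P \<Longrightarrow> q \<in> P \<Longrightarrow> p \<noteq> q \<Longrightarrow> h \<le> dist p q"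
  shows "card P * h ^ (DIM('a) - 1) \<le> real DIM('a) * 4 ^ DIM('a)"
proof -
  let ?n = "DIM('a)"
  let ?V = "measure lborel (ball (0::'a) 1)"
  have V: "?V > 0" by (rule content_ball_pos) simp
  have fin: "emeasure lborel (ball (x::'a) r) \<noteq> \<infinity>" "emeasure lborel (cball (x::'a) r) \<noteq> \<infinity>" for x r
    using emeasure_lborel_ball_finite[of x r] emeasure_lborel_cball_finite[of x r] by auto
  have "card P * ((h / 2) ^ ?n * ?V) = (\<Sum>p\<in>P. measure lborel (ball p (h / 2)))"
    using h by (simp add: content_ball_conv_unit_ball[of "h / 2"])
  also have "\<dots> = measure lborel (\<Union>p\<in>P. ball p (h / 2))"
  proof (rule measure_finite_Union[symmetric])
    show "disjoint_family_on (\<lambda>p. ball p (h / 2)) P"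
      unfolding disjoint_family_on_def
    proof (intro ballI impI equals0I)
      fix p q x assume pq: "p \<in> P" "q \<in> P" "p \<noteq> q" and x: "x \<in> ball p (h / 2) \<inter> ball q (h / 2)"
      have "dist p q \<le> dist p x + dist q x" by (rule dist_triangle2)
      also have "\<dots> < h" using x by (simp add: dist_commute)
      finally show False using sep[OF pq] by simp
    qed
  qed (use P fin in auto)
  also have "\<dots> \<le> measure lborel (cball (0::'a) (1 + h / 2) - ball 0 (1 - h / 2))"
  proof (rule measure_mono_fmeasurable)
    show "(\<Union>p\<in>P. ball p (h / 2)) \<subseteq> cball (0::'a) (1 + h / 2) - ball 0 (1 - h / 2)"
    proof safe
      fix p x assume p: "p \<in> P" and x: "x \<in> ball p (h / 2)"
      have n: "norm p = 1" "norm (p - x) < h / 2" using p x P by (auto simp: dist_norm)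
      show "x \<in> cball 0 (1 + h / 2)"
        using norm_triangle_ineq2[of x p] n by (simp add: norm_minus_commute)
      assume "x \<in> ball 0 (1 - h / 2)"
      then show False
        using norm_triangle_ineq2[of p x] n by simp
    qed
    have "cball (0::'a) (1 + h / 2) \<in> fmeasurable lborel"
      using emeasure_lborel_cball_finite by (intro fmeasurableI) auto
    then show "cball (0::'a) (1 + h / 2) - ball 0 (1 - h / 2) \<in> fmeasurable lborel"
      by (rule fmeasurableI2) auto
    show "(\<Union>p\<in>P. ball p (h / 2)) \<in> sets lborel"
      using P(1) by (intro sets.finite_UN) auto
  qed
  also have "\<dots> = measure lborel (cball (0::'a) (1 + h / 2)) - measure lborel (ball (0::'a) (1 - h / 2))"
  proof (rule measure_Diff)
    have "ball (0::'a) (1 - h / 2) \<subseteq> ball 0 (1 + h / 2)" using h by (intro subset_ball) simp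
    then show "ball (0::'a) (1 - h / 2) \<subseteq> cball 0 (1 + h / 2)" using ball_subset_cball by blast
  qed (use fin in auto)
  also have "\<dots> = ((1 + h / 2) ^ ?n - (1 - h / 2) ^ ?n) * ?V"
    using h by (simp add: content_cball_conv_ball content_ball_conv_unit_ball[of "1 + h / 2"]
        content_ball_conv_unit_ball[of "1 - h / 2"] left_diff_distrib)
  also have "\<dots> \<le> (real ?n * h * 2 ^ ?n) * ?V"
  proof (intro mult_right_mono less_imp_le[OF V])
    have "(1 + h / 2) ^ ?n - (1 - h / 2) ^ ?n \<le> real ?n * ((1 + h / 2) - (1 - h / 2)) * (1 + h / 2) ^ (?n - 1)"
      using h by (intro power_diff_le_real) auto
    also have "\<dots> \<le> real ?n * h * 2 ^ (?n - 1)"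
      using h by (auto intro!: mult_left_mono power_mono)
    also have "\<dots> \<le> real ?n * h * 2 ^ ?n"
      using h by (intro mult_left_mono power_increasing) auto
    finally show "(1 + h / 2) ^ ?n - (1 - h / 2) ^ ?n \<le> real ?n * h * 2 ^ ?n" .
  qed
  finally have "card P * (h / 2) ^ ?n \<le> real ?n * h * 2 ^ ?n"
    using V by (simp flip: mult.assoc)
  then have "card P * h ^ ?n \<le> real ?n * h * 2 ^ ?n * 2 ^ ?n"
    by (simp add: power_divide pos_divide_le_eq)
  also have "\<dots> = h * (real ?n * 4 ^ ?n)"
    by (simp flip: power_mult_distrib)
  also have "card P * h ^ ?n = h * (card P * h ^ (?n - 1))"
    using power_Suc[of h "?n - 1"] by (simp add: mult_ac)
  finally show ?thesis using h by (simp del: mult_le_cancel_left)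
qed

text \<open>A separated set of maximal cardinality is a net.\<close>

lemma sphere_net:
  fixes h :: real
  assumes h: "0 < h" "h \<le> 1"
  obtains P :: "'a::euclidean_space set" where "finite P" "P \<subseteq> sphere 0 1"
    "\<And>x. x \<in> sphere 0 1 \<Longrightarrow> \<exists>p\<in>P. dist x p < h" "card P * h ^ (DIM('a) - 1) \<le> real DIM('a) * 4 ^ DIM('a)"
proof -
  define Q where "Q P \<longleftrightarrow> finite P \<and> P \<subseteq> sphere (0::'a) 1 \<and>
    (\<forall>p\<in>P. \<forall>q\<in>P. p \<noteq> q \<longrightarrow> h \<le> dist p q)" for P
  let ?C = "real DIM('a) * 4 ^ DIM('a) / h ^ (DIM('a) - 1)"
  have le: "card P * h ^ (DIM('a) - 1) \<le> real DIM('a) * 4 ^ DIM('a)" if "Q P" for P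
    using that by (intro card_separated_subset_sphere_le[OF h]) (simp_all add: Q_def)
  have bound: "card P \<le> nat \<lfloor>?C\<rfloor>" if "Q P" for P
  proof -
    have "card P \<le> ?C" using le[OF that] h by (simp add: pos_le_divide_eq)
    then show ?thesis by linarith
  qed
  have "Q {}" by (simp add: Q_def)
  moreover have "\<forall>P. Q P \<longrightarrow> card P < Suc (nat \<lfloor>?C\<rfloor>)" using bound by (simp add: less_Suc_eq_le)
  ultimately have "\<exists>P. Q P \<and> (\<forall>P'. Q P' \<longrightarrow> card P' \<le> card P)"
    by (rule ex_has_greatest_nat)
  then obtain P where P: "Q P" "\<And>P'. Q P' \<Longrightarrow> card P' \<le> card P" by auto
  show thesis
  proof (rule that)
    fix x :: 'a assume x: "x \<in> sphere 0 1"
    show "\<exists>p\<in>P. dist x p < h"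
    proof (rule ccontr)
      assume neg: "\<not> ?thesis"
      have "x \<notin> P"
      proof
        assume "x \<in> P"
        then have "\<not> dist x x < h" using neg by blast
        then show False using h(1) by simp
      qed
      moreover have "Q (insert x P)"
        using P(1) neg x by (auto simp: Q_def not_less dist_commute)
      ultimately show False using P(2)[of "insert x P"] P(1) by (simp add: Q_def)
    qed
  qed (use P(1) le in \<open>auto simp: Q_def\<close>)
qed

section \<open>Sweeping a cap by tilted slabs\<close>

lemma frame_inner_le_norm:
  fixes u :: "nat \<Rightarrow> real ^ 'n"
  assumes "orthonormal_frame u" "i \<in> {1..CARD('n)}"
  shows "\<bar>x \<bullet> u i\<bar> \<le> norm x"
proof -
  have "norm (u i) = 1" using assms by (simp add: orthonormal_frame_def norm_eq_1)
  then show ?thesis using Cauchy_Schwarz_ineq2[of x "u i"] by simp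
qed

lemma orthonormal_frame_with_last:
  fixes p :: "real ^ 'n"
  assumes "norm p = 1"
  obtains e where "orthonormal_frame e" "e (CARD('n)) = p"
proof -
  let ?K = "{1..CARD('n)}"
  have "card ?K = card (Basis :: (real ^ 'n) set)" by simp
  then obtain \<beta> where \<beta>: "bij_betw \<beta> ?K (Basis :: (real ^ 'n) set)"
    using finite_same_card_bij[of ?K "Basis :: (real ^ 'n) set"] by auto
  have \<beta>B: "\<beta> i \<in> Basis" if "i \<in> ?K" for i using \<beta> that by (auto simp: bij_betw_def)
  have n: "CARD('n) \<in> ?K" by (simp add: Suc_leI)
  obtain f where f: "orthogonal_transformation f" "f (\<beta> (CARD('n))) = p"
    using orthogonal_transformation_exists_1[of "\<beta> (CARD('n))" p] \<beta>B[OF n] assms by auto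
  have "orthonormal_frame (\<lambda>i. f (\<beta> i))"
    unfolding orthonormal_frame_def
  proof (intro ballI)
    fix i j assume ij: "i \<in> ?K" "j \<in> ?K"
    have "f (\<beta> i) \<bullet> f (\<beta> j) = \<beta> i \<bullet> \<beta> j" using f(1) by (simp add: orthogonal_transformation_def)
    also have "\<dots> = (if \<beta> i = \<beta> j then 1 else 0)" using \<beta>B ij by (simp add: inner_Basis)
    also have "\<beta> i = \<beta> j \<longleftrightarrow> i = j" using \<beta> ij by (metis bij_betw_def inj_on_eq_iff)
    finally show "f (\<beta> i) \<bullet> f (\<beta> j) = (if i = j then 1 else 0)" .
  qed
  then show thesis using that f(2) by blast
qed

text \<open>The frame \<open>e\<close> rotated by the angle \<open>\<theta>\<close> in the plane of its first and last vectors.\<close>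

definition tilt :: "nat \<Rightarrow> real \<Rightarrow> (nat \<Rightarrow> real ^ 'n) \<Rightarrow> nat \<Rightarrow> real ^ 'n" where
  "tilt n \<theta> e i =
     (if i = 1 then cos \<theta> *\<^sub>R e 1 - sin \<theta> *\<^sub>R e n
      else if i = n then cos \<theta> *\<^sub>R e n + sin \<theta> *\<^sub>R e 1 else e i)"

lemma orthonormal_frame_tilt:
  fixes e :: "nat \<Rightarrow> real ^ 'n"
  assumes "orthonormal_frame e" "CARD('n) \<ge> 2"
  shows "orthonormal_frame (tilt (CARD('n)) \<theta> e)"
proof -
  have e: "e i \<bullet> e j = (if i = j then 1 else 0)" if "i \<in> {1..CARD('n)}" "j \<in> {1..CARD('n)}" for i j
    using assms(1) that by (simp add: orthonormal_frame_def)
  have n: "1 \<in> {1..CARD('n)}" "CARD('n) \<in> {1..CARD('n)}" "CARD('n) \<noteq> 1" using assms(2) by auto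
  note last = e[OF n(1) n(1)] e[OF n(1) n(2)] e[OF n(2) n(1)] e[OF n(2) n(2)]
  let ?t = "tilt (CARD('n)) \<theta> e"
  have other: "?t i = e i" "?t i \<bullet> e 1 = 0" "?t i \<bullet> e (CARD('n)) = 0" "e 1 \<bullet> ?t i = 0" "e (CARD('n)) \<bullet> ?t i = 0"
    if "i \<in> {1..CARD('n)}" "i \<noteq> 1" "i \<noteq> CARD('n)" for i
    using that n e[OF that(1) n(1)] e[OF that(1) n(2)] by (simp_all add: tilt_def inner_commute)
  have t1: "?t 1 = cos \<theta> *\<^sub>R e 1 - sin \<theta> *\<^sub>R e (CARD('n))"
    and tn: "?t (CARD('n)) = cos \<theta> *\<^sub>R e (CARD('n)) + sin \<theta> *\<^sub>R e 1"
    using n(3) by (simp_all add: tilt_def)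
  show ?thesis
    unfolding orthonormal_frame_def
  proof (intro ballI)
    fix i j assume ij: "i \<in> {1..CARD('n)}" "j \<in> {1..CARD('n)}"
    consider "i = 1" "j = 1" | "i = 1" "j = CARD('n)" | "i = 1" "j \<noteq> 1" "j \<noteq> CARD('n)"
      | "i = CARD('n)" "j = 1" | "i = CARD('n)" "j = CARD('n)" | "i = CARD('n)" "j \<noteq> 1" "j \<noteq> CARD('n)"
      | "i \<noteq> 1" "i \<noteq> CARD('n)" "j = 1" | "i \<noteq> 1" "i \<noteq> CARD('n)" "j = CARD('n)"
      | "i \<noteq> 1" "i \<noteq> CARD('n)" "j \<noteq> 1" "j \<noteq> CARD('n)" by blast
    then show "?t i \<bullet> ?t j = (if i = j then 1 else 0)"
    proof cases
      case 9
      then show ?thesis using e[OF ij] other(1)[OF ij(1)] other(1)[OF ij(2)] by simp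
    qed (use ij n(3) last other in \<open>simp_all add: t1 tn inner_diff_left inner_diff_right inner_add_left inner_add_right algebra_simps del: One_nat_def\<close>)
  qed
qed

lemma discrete_crossing:
  fixes f :: "nat \<Rightarrow> real"
  assumes "f 0 \<ge> t" "f J \<le> t" "\<And>j. j < J \<Longrightarrow> f j - f (Suc j) \<le> \<epsilon>" "\<epsilon> \<ge> 0"
  obtains j where "j \<le> J" "\<bar>f j - t\<bar> \<le> \<epsilon>"
proof -
  define j where "j = (LEAST j. f j \<le> t)"
  have j: "f j \<le> t" unfolding j_def using assms(2) by (rule LeastI)
  have jJ: "j \<le> J" unfolding j_def using assms(2) by (rule Least_le)
  show thesis
  proof (cases j)
    case 0
    then show thesis using j assms(1,4) by (intro that[of 0]) auto
  next
    case (Suc i)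
    have "\<not> f i \<le> t" using not_less_Least[of i "\<lambda>j. f j \<le> t"] Suc by (simp add: j_def)
    then show thesis using j assms(3)[of i] Suc jJ by (intro that[of j]) auto
  qed
qed

lemma cos_le_quadratic:
  fixes x :: real
  assumes "0 \<le> x" "x \<le> 1"
  shows "cos x \<le> 1 - 9 / 32 * x\<^sup>2"
proof -
  define y where "y = x / 2"
  have y: "0 \<le> y" "y \<le> 1" using assms by (auto simp: y_def)
  have sum3: "(\<Sum>m<3. sin_coeff m * y ^ m) = y"
    by (simp add: numeral_3_eq_3 sin_coeff_def)
  have fact3: "fact 3 = (6::real)" by (simp add: fact_numeral)
  have "\<bar>sin y - y\<bar> \<le> inverse 6 * \<bar>y\<bar> ^ 3"
    using Maclaurin_sin_bound[of y 3] unfolding sum3 fact3 .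
  then have "\<bar>sin y - y\<bar> \<le> y ^ 3 / 6" using y by (simp add: abs_of_nonneg)
  moreover have "y ^ 3 \<le> y" using y power_decreasing[of 1 3 y] by simp
  ultimately have "3 / 4 * y \<le> sin y" using y by linarith
  then have "(3 / 4 * y)\<^sup>2 \<le> (sin y)\<^sup>2" using y by (intro power_mono) auto
  then have "9 / 16 * y\<^sup>2 \<le> (sin y)\<^sup>2" by (simp add: power_mult_distrib power2_eq_square)
  moreover have "cos x = 1 - 2 * (sin y)\<^sup>2" using cos_double_sin[of y] by (simp add: y_def)
  ultimately show ?thesis by (simp add: y_def power_divide)
qed

text \<open>Follow the last coordinate \<open>f j\<close> of \<open>x\<close> in the frame tilted by \<open>j * \<eta>\<close>, where \<open>J\<close> steps make up the
  angle \<open>\<rho> / 4\<close>. Membership in the cap gives \<open>f 0 \<ge> 1 - \<rho>\<^sup>2 / 512\<close>. At the angle \<open>\<rho> / 4\<close> the centre of the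
  cap has dropped by about \<open>\<rho>\<^sup>2 / 32\<close>, and \<open>x\<close> makes up for at most \<open>\<rho>\<^sup>2 / 64\<close> of this, so \<open>f J\<close> is below
  that level. One step changes \<open>f\<close> by \<open>O(\<rho> * \<eta>) = O(\<rho>\<^sup>2 / J)\<close>, hence by at most \<open>d / 4\<close>, so that some
  \<open>f j\<close> lies in the slab.\<close>

lemma tilted_slab_exists:
  fixes e :: "nat \<Rightarrow> real ^ 'n" and \<rho> d :: real and x :: "real ^ 'n"
  assumes e: "orthonormal_frame e" and n: "CARD('n) \<ge> 2"
    and \<rho>: "0 < \<rho>" "\<rho> \<le> 1" and d: "0 < d" "d \<le> \<rho>\<^sup>2" and J: "\<rho>\<^sup>2 / d \<le> real J"
    and x: "norm x = 1" "dist x (e (CARD('n))) < \<rho> / 16"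
  obtains j :: nat where "j \<le> J"
    "\<bar>x \<bullet> tilt (CARD('n)) (j * (\<rho> / (4 * J))) e (CARD('n)) - (1 - \<rho>\<^sup>2 / 512)\<bar> < d / 2"
    "\<And>i. i \<in> {1..<CARD('n)} \<Longrightarrow> \<bar>x \<bullet> tilt (CARD('n)) (j * (\<rho> / (4 * J))) e i\<bar> \<le> \<rho> / 2"
proof -
  let ?n = "CARD('n)"
  let ?p = "e ?n"
  have idx: "1 \<in> {1..?n}" "?n \<in> {1..?n}" "?n \<noteq> 1" using n by auto
  have ee: "e i \<bullet> e j = (if i = j then 1 else 0)" if "i \<in> {1..?n}" "j \<in> {1..?n}" for i j
    using e that by (simp add: orthonormal_frame_def)
  have np: "norm ?p = 1" using ee[OF idx(2) idx(2)] by (simp add: norm_eq_1)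
  define a where "a = x \<bullet> ?p"
  define b where "b = x \<bullet> e 1"
  have xi: "\<bar>x \<bullet> e i\<bar> \<le> \<rho> / 16" if "i \<in> {1..<?n}" for i
  proof -
    have "x \<bullet> e i = (x - ?p) \<bullet> e i" using ee[of ?n i] that idx by (simp add: inner_diff_left)
    also have "\<bar>\<dots>\<bar> \<le> norm (x - ?p)" using frame_inner_le_norm[OF e, of i] that by simp
    finally show ?thesis using x(2) by (simp add: dist_norm)
  qed
  have b: "\<bar>b\<bar> \<le> \<rho> / 16" unfolding b_def using xi[of 1] n by simp
  have "(norm (x - ?p))\<^sup>2 = 2 - 2 * a"
    using x(1) np by (simp add: power2_norm_eq_inner inner_diff_left inner_diff_right a_def inner_commute norm_eq_1)
  moreover have "(norm (x - ?p))\<^sup>2 \<le> (\<rho> / 16)\<^sup>2"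
    using x(2) by (intro power_mono) (auto simp: dist_norm)
  ultimately have a: "1 - \<rho>\<^sup>2 / 512 \<le> a" by (simp add: power_divide)
  have a1: "\<bar>a\<bar> \<le> 1" using frame_inner_le_norm[OF e idx(2), of x] x(1) by (simp add: a_def)
  have a0: "0 \<le> a" using a \<rho> power_le_one[of \<rho> 2] by simp
  have \<rho>2: "0 < \<rho>\<^sup>2" using \<rho> by simp
  have Jpos: "0 < real J"
    using J d \<rho>2 by (meson divide_pos_pos less_le_trans)
  define \<eta> where "\<eta> = \<rho> / (4 * J)"
  have \<eta>: "0 < \<eta>" "J * \<eta> = \<rho> / 4" using \<rho> Jpos by (auto simp: \<eta>_def)
  define f where "f j = a * cos (j * \<eta>) + b * sin (j * \<eta>)" for j :: nat
  have J\<eta>: "j * \<eta> \<le> \<rho> / 4" if "j \<le> J" for j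
  proof -
    have "j * \<eta> \<le> J * \<eta>" using that \<eta> by (intro mult_right_mono) auto
    then show ?thesis using \<eta>(2) by linarith
  qed
  have "\<rho> * \<eta> \<le> d / 4"
  proof -
    have "\<rho>\<^sup>2 \<le> real J * d" using J d by (simp add: pos_divide_le_eq)
    then show ?thesis using Jpos by (simp add: \<eta>_def power2_eq_square field_simps)
  qed
  have step: "f j - f (Suc j) \<le> d / 4" if "j < J" for j
  proof -
    define x where "x = j * \<eta>"
    define y where "y = Suc j * \<eta>"
    have "0 \<le> x" using \<eta> by (simp add: x_def)
    moreover have yx: "y - x = \<eta>" by (simp add: x_def y_def algebra_simps)
    moreover have "y \<le> \<rho> / 4" using J\<eta>[of "Suc j"] that by (simp add: y_def)
    ultimately have xy: "0 \<le> x" "x \<le> y" "y \<le> \<rho> / 4" using \<eta>(1) by linarith+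
    have cosd: "\<bar>cos x - cos y\<bar> \<le> \<rho> / 4 * \<eta>"
    proof -
      have "\<bar>cos x - cos y\<bar> = 2 * \<bar>sin ((x + y) / 2)\<bar> * \<bar>sin ((y - x) / 2)\<bar>"
        unfolding cos_diff_cos by (simp add: abs_mult)
      also have "\<dots> \<le> 2 * (\<rho> / 4) * (\<eta> / 2)"
      proof (intro mult_mono)
        show "\<bar>sin ((x + y) / 2)\<bar> \<le> \<rho> / 4"
          by (rule order.trans[OF abs_sin_x_le_abs_x]) (use xy in simp)
        show "\<bar>sin ((y - x) / 2)\<bar> \<le> \<eta> / 2"
          by (rule order.trans[OF abs_sin_x_le_abs_x]) (use xy yx in simp)
      qed (use \<rho> in auto)
      finally show ?thesis by simp
    qed
    have sind: "\<bar>sin x - sin y\<bar> \<le> \<eta>"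
    proof -
      have "\<bar>sin x - sin y\<bar> = 2 * \<bar>sin ((x - y) / 2)\<bar> * \<bar>cos ((x + y) / 2)\<bar>"
        unfolding sin_diff_sin by (simp add: abs_mult)
      also have "\<dots> \<le> 2 * (\<eta> / 2) * 1"
      proof (intro mult_mono)
        show "\<bar>sin ((x - y) / 2)\<bar> \<le> \<eta> / 2"
          by (rule order.trans[OF abs_sin_x_le_abs_x]) (use xy yx in simp)
      qed (use \<eta> in auto)
      finally show ?thesis by simp
    qed
    have "f j - f (Suc j) = a * (cos x - cos y) + b * (sin x - sin y)"
      by (simp add: f_def x_def y_def algebra_simps)
    moreover have "\<bar>a * (cos x - cos y)\<bar> \<le> 1 * (\<rho> / 4 * \<eta>)"
      unfolding abs_mult using a1 cosd by (intro mult_mono) auto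
    moreover have "\<bar>b * (sin x - sin y)\<bar> \<le> \<rho> / 16 * \<eta>"
      unfolding abs_mult using b sind by (intro mult_mono) auto
    ultimately have "f j - f (Suc j) \<le> \<rho> / 4 * \<eta> + \<rho> / 16 * \<eta>" by linarith
    also have "\<dots> \<le> \<rho> * \<eta>" using \<rho> \<eta> by simp
    finally show ?thesis using \<open>\<rho> * \<eta> \<le> d / 4\<close> by linarith
  qed
  have f0: "f 0 \<ge> 1 - \<rho>\<^sup>2 / 512" using a by (simp add: f_def)
  have fJ: "f J \<le> 1 - \<rho>\<^sup>2 / 512"
  proof -
    have "cos (\<rho> / 4) \<le> 1 - 9 / 32 * (\<rho> / 4)\<^sup>2" using \<rho> by (intro cos_le_quadratic) auto
    moreover have "0 \<le> cos (\<rho> / 4)" using \<rho> pi_gt3 by (intro cos_ge_zero) auto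
    ultimately have "a * cos (\<rho> / 4) \<le> 1 * (1 - 9 / 32 * (\<rho> / 4)\<^sup>2)"
      using a0 a1 by (intro mult_mono) auto
    moreover have "b * sin (\<rho> / 4) \<le> \<rho> / 16 * (\<rho> / 4)"
    proof -
      have "b * sin (\<rho> / 4) \<le> \<bar>b\<bar> * \<bar>sin (\<rho> / 4)\<bar>" by (metis abs_ge_self abs_mult)
      also have "\<dots> \<le> \<rho> / 16 * (\<rho> / 4)"
        using b \<rho> abs_sin_x_le_abs_x[of "\<rho> / 4"] by (intro mult_mono) auto
      finally show ?thesis .
    qed
    ultimately show ?thesis by (simp add: f_def \<eta>(2) power2_eq_square)
  qed
  obtain j where j: "j \<le> J" "\<bar>f j - (1 - \<rho>\<^sup>2 / 512)\<bar> \<le> d / 4"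
    using discrete_crossing[OF f0 fJ step] d by auto
  have fj: "x \<bullet> tilt ?n (j * \<eta>) e ?n = f j"
    using idx by (simp add: tilt_def f_def a_def b_def inner_add_right mult.commute)
  have "\<bar>x \<bullet> tilt ?n (j * \<eta>) e i\<bar> \<le> \<rho> / 2" if i: "i \<in> {1..<?n}" for i
  proof (cases "i = 1")
    case True
    have "x \<bullet> tilt ?n (j * \<eta>) e i = cos (j * \<eta>) * b - sin (j * \<eta>) * a"
      by (simp add: True tilt_def a_def b_def inner_diff_right)
    moreover have "\<bar>cos (j * \<eta>) * b\<bar> \<le> 1 * (\<rho> / 16)"
      unfolding abs_mult using b by (intro mult_mono) auto
    moreover have "\<bar>sin (j * \<eta>) * a\<bar> \<le> \<rho> / 4 * 1"
    proof -
      have "\<bar>sin (j * \<eta>)\<bar> \<le> \<rho> / 4" using abs_sin_x_le_abs_x[of "j * \<eta>"] J\<eta>[OF j(1)] \<eta> by simp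
      then show ?thesis unfolding abs_mult using a1 by (intro mult_mono) auto
    qed
    ultimately show ?thesis by linarith
  next
    case False
    then have "tilt ?n (j * \<eta>) e i = e i" using i by (simp add: tilt_def)
    then show ?thesis using xi[OF i] \<rho> by simp
  qed
  then show thesis using that[OF j(1)] j(2) fj d by (simp add: \<eta>_def)
qed

section \<open>The upper bound\<close>

definition frame_box :: "(nat \<Rightarrow> real) \<Rightarrow> (nat \<Rightarrow> real) \<Rightarrow> (nat \<Rightarrow> real ^ 'n) \<Rightarrow> (real ^ 'n) set" where
  "frame_box c l u = {x. \<forall>i\<in>{1..CARD('n)}. \<bar>x \<bullet> u i - c i\<bar> < l i / 2}"

lemma open_box_frame_box:
  fixes u :: "nat \<Rightarrow> real ^ 'n"
  assumes "orthonormal_frame u" "\<delta> \<in> Delta (CARD('n))"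
  shows "open_box \<delta> (frame_box c \<delta> u)"
proof -
  let ?a = "\<Sum>j\<in>{1..CARD('n)}. c j *\<^sub>R u j"
  have "frame_box c \<delta> u = {x. \<forall>i\<in>{1..CARD('n)}. \<bar>(x - ?a) \<bullet> u i\<bar> < \<delta> i / 2}"
    unfolding frame_box_def
    by (intro Collect_cong ball_cong refl) (simp only: inner_diff_left inner_orthonormal_frame_sum[OF assms(1)])
  then show ?thesis
    unfolding open_box_def using assms unfolding Delta_def orthonormal_frame_def
    by (intro conjI exI[of _ ?a] exI[of _ u]) simp_all
qed

text \<open>The boxes are indexed by the tilt \<open>j\<close> that brings \<open>x\<close> into the slab and by the cell \<open>k\<close> of the other
  \<open>m\<close> coordinates of \<open>x\<close> in the tilted frame. These coordinates are at most \<open>\<rho> / 2\<close>, so \<open>O(\<rho> / s i)\<close> cells of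
  size \<open>s i\<close> suffice for coordinate \<open>i\<close>.\<close>

lemma cap_box_cover:
  fixes p :: "real ^ 'n" and \<delta> s :: "nat \<Rightarrow> real" and \<rho> :: real
  assumes n: "CARD('n) = m + 1" "m \<ge> 1" and \<delta>: "\<delta> \<in> Delta (m + 1)" and p: "norm p = 1"
    and \<rho>: "0 < \<rho>" "\<rho> \<le> 1" "\<delta> (m + 1) \<le> \<rho>\<^sup>2"
    and s: "\<And>i. i \<in> {1..m} \<Longrightarrow> 0 < s i \<and> s i \<le> \<delta> i \<and> s i \<le> \<rho>"
  obtains \<B> where "finite \<B>" "box_cover (sphere 0 1 \<inter> ball p (\<rho> / 16)) \<delta> \<B>"
    "real (card \<B>) \<le> 3 * (\<rho>\<^sup>2 / \<delta> (m + 1)) * (\<Prod>i=1..m. 5 * \<rho> / s i)"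
proof -
  let ?n = "CARD('n)"
  define d where "d = \<delta> (m + 1)"
  have d: "0 < d" "d \<le> \<rho>\<^sup>2" using Delta_pos[OF \<delta>, of "m+1"] \<rho>(3) by (auto simp: d_def)
  obtain e :: "nat \<Rightarrow> real ^ 'n" where e: "orthonormal_frame e" "e ?n = p"
    using orthonormal_frame_with_last[OF p] by blast
  define J where "J = nat \<lceil>\<rho>\<^sup>2 / d\<rceil>"
  have r1: "1 \<le> \<rho>\<^sup>2 / d" using d by simp
  have J: "\<rho>\<^sup>2 / d \<le> real J" "real J \<le> \<rho>\<^sup>2 / d + 1"
    unfolding J_def using r1 by linarith+
  define q where "q i = \<lfloor>2 * \<rho> / s i\<rfloor>" for i
  define U where "U j = tilt ?n (real j * (\<rho> / (4 * J))) e" for j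
  \<comment> \<open>Rounding down to a multiple of \<open>s i / 2\<close> has an error strictly below \<open>s i / 2\<close>, as open boxes require.\<close>
  define c where "c k i = (if i = ?n then 1 - \<rho>\<^sup>2 / 512 else real_of_int (k i) * (s i / 2))" for k :: "nat \<Rightarrow> int" and i
  define Idx where "Idx = {0..J} \<times> (\<Pi>\<^sub>E i\<in>{1..m}. {- q i..q i})"
  define \<B> where "\<B> = (\<lambda>(j, k). frame_box (c k) \<delta> (U j)) ` Idx"
  have fin: "finite Idx" unfolding Idx_def by (intro finite_cartesian_product finite_PiE) auto
  have U: "orthonormal_frame (U j)" for j
    unfolding U_def using e(1) n by (intro orthonormal_frame_tilt) auto
  have "card Idx = (J + 1) * (\<Prod>i=1..m. card {- q i..q i})"
    by (simp add: Idx_def card_cartesian_product card_PiE)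
  then have "real (card Idx) = (real J + 1) * (\<Prod>i=1..m. real (card {- q i..q i}))"
    by (simp only: of_nat_mult of_nat_add of_nat_1 of_nat_prod)
  also have "\<dots> \<le> (3 * (\<rho>\<^sup>2 / d)) * (\<Prod>i=1..m. 5 * \<rho> / s i)"
  proof (intro mult_mono prod_mono conjI)
    show "real J + 1 \<le> 3 * (\<rho>\<^sup>2 / d)" using J r1 by linarith
    fix i assume i: "i \<in> {1..m}"
    have "1 \<le> \<rho> / s i" using s[OF i] by simp
    moreover from this have "0 \<le> q i" by (simp add: q_def)
    moreover have "real_of_int (q i) \<le> 2 * (\<rho> / s i)" unfolding q_def by linarith
    ultimately show "real (card {- q i..q i}) \<le> 5 * \<rho> / s i" by simp
  qed (use d in \<open>auto intro!: prod_nonneg\<close>)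
  finally have card: "real (card Idx) \<le> 3 * (\<rho>\<^sup>2 / d) * (\<Prod>i=1..m. 5 * \<rho> / s i)" .
  show thesis
  proof (rule that)
    show "finite \<B>" unfolding \<B>_def using fin by simp
    have "real (card \<B>) \<le> real (card Idx)" unfolding \<B>_def using card_image_le[OF fin] by simp
    with card show "real (card \<B>) \<le> 3 * (\<rho>\<^sup>2 / \<delta> (m + 1)) * (\<Prod>i=1..m. 5 * \<rho> / s i)"
      by (simp add: d_def)
    show "box_cover (sphere 0 1 \<inter> ball p (\<rho> / 16)) \<delta> \<B>"
      unfolding box_cover_def
    proof (intro conjI ballI subsetI)
      fix B assume "B \<in> \<B>"
      then obtain j k where "B = frame_box (c k) \<delta> (U j)" unfolding \<B>_def by auto
      then have "open_box \<delta> B" using open_box_frame_box[OF U] \<delta> n by metis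
      then show "\<exists>l. open_box l B \<and> (\<forall>i\<in>{1..?n}. l i \<le> \<delta> i)" by blast
    next
      fix x assume x: "x \<in> sphere 0 1 \<inter> ball p (\<rho> / 16)"
      obtain j where j: "j \<le> J" "\<bar>x \<bullet> U j ?n - (1 - \<rho>\<^sup>2 / 512)\<bar> < d / 2"
        "\<And>i. i \<in> {1..<?n} \<Longrightarrow> \<bar>x \<bullet> U j i\<bar> \<le> \<rho> / 2"
      proof (rule tilted_slab_exists[OF e(1) _ \<rho>(1,2) d J(1), of x])
        show "2 \<le> ?n" using n by simp
        show "norm x = 1" "dist x (e ?n) < \<rho> / 16" using x e(2) by (auto simp: dist_commute)
      qed (auto simp: U_def)
      define k where "k = (\<lambda>i\<in>{1..m}. \<lfloor>2 * (x \<bullet> U j i) / s i\<rfloor>)"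
      have "\<bar>x \<bullet> U j i - k i * (s i / 2)\<bar> < s i / 2 \<and> k i \<in> {- q i..q i}" if i: "i \<in> {1..m}" for i
      proof -
        define y where "y = 2 * (x \<bullet> U j i) / s i"
        have si: "0 < s i" "s i \<le> \<rho>" using s[OF i] by auto
        have k: "k i = \<lfloor>y\<rfloor>" using i by (simp add: k_def y_def)
        have xy: "x \<bullet> U j i = y * (s i / 2)" using si by (simp add: y_def)
        have "\<bar>x \<bullet> U j i - k i * (s i / 2)\<bar> = \<bar>y - k i\<bar> * (s i / 2)"
          unfolding xy left_diff_distrib[symmetric] abs_mult using si by simp
        also have "\<dots> < 1 * (s i / 2)"
          unfolding k using si by (intro mult_strict_right_mono) linarith+
        finally have 1: "\<bar>x \<bullet> U j i - k i * (s i / 2)\<bar> < s i / 2" by simp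
        have "\<bar>y\<bar> * (s i / 2) \<le> \<rho> / 2"
          using j(3)[of i] i n xy si by (simp add: abs_mult)
        then have y: "\<bar>y\<bar> \<le> \<rho> / s i" using si by (simp add: pos_le_divide_eq)
        have "1 \<le> \<rho> / s i" using si by simp
        then have "y \<le> 2 * \<rho> / s i" "- (2 * \<rho> / s i) + 1 \<le> y" 
          using y unfolding times_divide_eq_right[symmetric] by linarith+
        then have "\<lfloor>y\<rfloor> \<le> q i" "- q i \<le> \<lfloor>y\<rfloor>" unfolding q_def by linarith+
        with 1 show ?thesis by (simp add: k)
      qed
      note k = this
      have "(j, k) \<in> Idx" unfolding Idx_def using j(1) k by (auto simp: PiE_iff k_def)
      moreover have "x \<in> frame_box (c k) \<delta> (U j)"
        unfolding frame_box_def
      proof (intro CollectI ballI)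
        fix i assume i: "i \<in> {1..?n}"
        show "\<bar>x \<bullet> U j i - c k i\<bar> < \<delta> i / 2"
        proof (cases "i = ?n")
          case True
          then show ?thesis using j(2) n by (simp add: c_def d_def)
        next
          case False
          then have "i \<in> {1..m}" using i n by auto
          then show ?thesis using k[of i] s[of i] False by (auto simp: c_def)
        qed
      qed
      ultimately show "x \<in> \<Union>\<B>" unfolding \<B>_def by force
    qed
  qed
qed

text \<open>If \<open>\<rho> = sqrt d\<close>, the left side is \<open>d * \<Gamma>\<close> and the product on the right is one of the three
  terms of \<open>\<Gamma>\<close>, depending on the position of \<open>sqrt d\<close> among \<open>\<delta> 1 \<ge> \<delta> 2\<close>. If \<open>\<rho> = \<delta> 3\<close>, the first two cell
  sides equal \<open>\<rho>\<close> and the right side is \<open>\<rho>\<^sup>2\<close> times the third term. For \<open>m = 2\<close> the entry \<open>\<delta> 3\<close> is \<open>d\<close>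
  itself, and \<open>\<rho> = sqrt d\<close>.\<close>

lemma Gamma_box_le_cell_product:
  fixes \<delta> :: "nat \<Rightarrow> real"
  assumes m: "m \<ge> 2" and \<delta>: "\<delta> \<in> Delta (m + 1)"
  defines "\<rho> \<equiv> max (sqrt (\<delta> (m + 1))) (\<delta> 3)"
  shows "\<rho>\<^sup>2 * Gamma_box m \<delta> \<le> \<delta> (m + 1) * (\<Prod>i=1..m. min (\<delta> i) \<rho>)"
proof -
  define d where "d = \<delta> (m + 1)"
  define C where "C = (\<Prod>i=3..m. \<delta> i)"
  have pos: "\<delta> i > 0" if "i \<in> {1..m+1}" for i using Delta_pos[OF \<delta> that] .
  have d: "0 < d" using pos by (simp add: d_def)
  have C: "C > 0" unfolding C_def by (auto intro!: prod_pos pos)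
  have \<rho>: "\<rho> > 0" "\<delta> 3 \<le> \<rho>" "sqrt d \<le> \<rho>" using d pos[of 3] m by (auto simp: \<rho>_def d_def max_def)
  have split: "(\<Prod>i=1..m. f i) = f 1 * (f 2 * (\<Prod>i=3..m. f i))" "(\<Prod>i=2..m. f i) = f 2 * (\<Prod>i=3..m. f i)" for f :: "nat \<Rightarrow> real"
    using m by (simp_all add: prod.atLeast_Suc_atMost numeral_2_eq_2 numeral_3_eq_3)
  have "(\<Prod>i=3..m. min (\<delta> i) \<rho>) = C"
    unfolding C_def
  proof (rule prod.cong[OF refl])
    fix i assume "i \<in> {3..m}"
    then have "\<delta> i \<le> \<delta> 3" using Delta_antimono[OF \<delta>, of 3 i] by simp
    then show "min (\<delta> i) \<rho> = \<delta> i" using \<rho>(2) by simp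
  qed
  then have prod: "(\<Prod>i=1..m. min (\<delta> i) \<rho>) = min (\<delta> 1) \<rho> * (min (\<delta> 2) \<rho> * C)"
    unfolding split(1)[of "\<lambda>i. min (\<delta> i) \<rho>"] by (simp only:)
  have \<Gamma>: "Gamma_box m \<delta> \<le> \<delta> 1 * (\<delta> 2 * C)" "Gamma_box m \<delta> \<le> sqrt d * (\<delta> 2 * C)" "Gamma_box m \<delta> \<le> d * C"
    using d unfolding Gamma_box_def split(1)[of \<delta>] split(2)[of \<delta>] C_def[symmetric] d_def[symmetric]
    by (simp_all add: powr_half_sqrt)
  have mono: "\<delta> 2 \<le> \<delta> 1" "\<delta> 3 \<le> \<delta> 2"
    using Delta_antimono[OF \<delta>, of 1 2] Delta_antimono[OF \<delta>, of 2 3] m by auto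
  show ?thesis
  proof (cases "\<delta> 3 \<le> sqrt d")
    case True
    then have \<rho>d: "\<rho> = sqrt d" "\<rho>\<^sup>2 = d" using d by (auto simp: \<rho>_def d_def)
    have "Gamma_box m \<delta> \<le> min (\<delta> 1) (sqrt d) * (min (\<delta> 2) (sqrt d) * C)"
    proof -
      consider "\<delta> 1 \<le> sqrt d" | "sqrt d < \<delta> 1" "\<delta> 2 \<le> sqrt d" | "sqrt d < \<delta> 2" by linarith
      then show ?thesis
        using \<Gamma> mono d by cases (simp_all add: min_absorb1 min_absorb2 flip: mult.assoc)
    qed
    then show ?thesis using d unfolding prod unfolding d_def[symmetric] \<rho>d by simp
  next
    case False
    then have "\<rho> = \<delta> 3" by (simp add: \<rho>_def d_def)
    then have eq: "min (\<delta> 1) \<rho> * (min (\<delta> 2) \<rho> * C) = \<rho>\<^sup>2 * C"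
      using mono by (simp add: power2_eq_square)
    have "\<rho>\<^sup>2 * Gamma_box m \<delta> \<le> \<rho>\<^sup>2 * (d * C)" using \<Gamma>(3) by (intro mult_left_mono) auto
    then show ?thesis unfolding prod eq d_def[symmetric] by (simp add: mult_ac)
  qed
qed

text \<open>The powers of \<open>\<rho>\<close> in the number of caps and in the number of cells per cap cancel. The constant
  \<open>80 = 16 * 5\<close> combines the cap radius \<open>\<rho> / 16\<close> with the \<open>5 * \<rho> / s i\<close> cells per coordinate.\<close>

lemma sphere_box_cover_exists:
  fixes \<delta> :: "nat \<Rightarrow> real"
  assumes m: "m \<ge> 2" "CARD('n::finite) = m + 1" and \<delta>: "\<delta> \<in> Delta (m + 1)"
  obtains \<B> :: "(real ^ 'n) set set" where "finite \<B>" "box_cover (sphere 0 1) \<delta> \<B>"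
    "real (card \<B>) \<le> real (m + 1) * 4 ^ (m + 1) * 3 * 80 ^ m * inverse (Gamma_box m \<delta>)"
proof -
  define d where "d = \<delta> (m + 1)"
  define \<rho> where "\<rho> = max (sqrt d) (\<delta> 3)"
  define s where "s i = min (\<delta> i) \<rho>" for i
  have pos: "\<delta> i > 0" if "i \<in> {1..m+1}" for i using Delta_pos[OF \<delta> that] .
  have lt1: "\<delta> i < 1" if "i \<in> {1..m+1}" for i using Delta_less_1[OF \<delta> that] .
  have d: "0 < d" "d < 1" using pos lt1 by (auto simp: d_def)
  have \<rho>: "0 < \<rho>" "\<rho> \<le> 1" using d pos[of 3] lt1[of 3] m by (auto simp: \<rho>_def max_def)
  have "(sqrt d)\<^sup>2 \<le> \<rho>\<^sup>2" using d by (intro power_mono) (auto simp: \<rho>_def)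
  then have \<rho>d: "d \<le> \<rho>\<^sup>2" using d by simp
  have s: "0 < s i \<and> s i \<le> \<delta> i \<and> s i \<le> \<rho>" if "i \<in> {1..m}" for i
    using that pos[of i] \<rho> by (simp add: s_def)
  define S where "S = (\<Prod>i=1..m. s i)"
  have S: "S > 0" unfolding S_def using s by (intro prod_pos) auto
  define N where "N = 3 * (\<rho>\<^sup>2 / d) * (\<Prod>i=1..m. 5 * \<rho> / s i)"
  have N: "N = 3 * (\<rho>\<^sup>2 / d) * (5 ^ m * \<rho> ^ m / S)"
    by (simp add: N_def S_def prod_dividef power_mult_distrib)
  have N0: "N \<ge> 0" unfolding N using d S \<rho> by simp
  have h: "0 < \<rho> / 16" "\<rho> / 16 \<le> 1" using \<rho> by auto
  obtain P :: "(real ^ 'n) set" where P: "finite P" "P \<subseteq> sphere 0 1"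
    "\<And>x. x \<in> sphere 0 1 \<Longrightarrow> \<exists>p\<in>P. dist x p < \<rho> / 16" "card P * (\<rho> / 16) ^ m \<le> real (m + 1) * 4 ^ (m + 1)"
    using sphere_net[OF h, where 'a = "real ^ 'n"] m by auto
  have "\<exists>\<B>. finite \<B> \<and> box_cover (sphere 0 1 \<inter> ball p (\<rho> / 16)) \<delta> \<B> \<and> real (card \<B>) \<le> N" if "p \<in> P" for p
  proof -
    have "norm p = 1" using P(2) that by auto
    have "m \<ge> 1" using m(1) by simp
    from cap_box_cover[OF m(2) this \<delta> \<open>norm p = 1\<close> \<rho> \<rho>d[unfolded d_def] s]
    show ?thesis unfolding N_def d_def by blast
  qed
  then obtain F where F: "\<And>p. p \<in> P \<Longrightarrow> finite (F p)"
    "\<And>p. p \<in> P \<Longrightarrow> box_cover (sphere 0 1 \<inter> ball p (\<rho> / 16)) \<delta> (F p)"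
    "\<And>p. p \<in> P \<Longrightarrow> real (card (F p)) \<le> N" by metis
  show thesis
  proof (rule that)
    show "finite (\<Union>p\<in>P. F p)" using P(1) F(1) by blast
    show "box_cover (sphere 0 1) \<delta> (\<Union>p\<in>P. F p)"
      unfolding box_cover_def
    proof (intro conjI subsetI ballI)
      fix x :: "real ^ 'n" assume x: "x \<in> sphere 0 1"
      then obtain p where p: "p \<in> P" "dist x p < \<rho> / 16" using P(3) by blast
      then have "x \<in> sphere 0 1 \<inter> ball p (\<rho> / 16)" using x by (simp add: dist_commute)
      then show "x \<in> \<Union>(\<Union>p\<in>P. F p)" using F(2)[OF p(1)] p(1) unfolding box_cover_def by blast
    next
      fix B assume "B \<in> (\<Union>p\<in>P. F p)"
      then show "\<exists>l. open_box l B \<and> (\<forall>i\<in>{1..CARD('n)}. l i \<le> \<delta> i)"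
        using F(2) unfolding box_cover_def by blast
    qed
    have \<Gamma>: "Gamma_box m \<delta> > 0" by (rule Gamma_box_pos[OF \<delta>])
    have "real (card (\<Union>p\<in>P. F p)) \<le> (\<Sum>p\<in>P. real (card (F p)))"
      using card_UN_le[OF P(1), of F] by (simp flip: of_nat_sum)
    also have "\<dots> \<le> card P * N" using sum_bounded_above[of P "\<lambda>p. real (card (F p))" N] F(3) by simp
    also have "\<dots> = card P * (\<rho> / 16) ^ m * (3 * 80 ^ m * (\<rho>\<^sup>2 / (d * S)))"
    proof -
      have "(80::real) ^ m = 16 ^ m * 5 ^ m" by (simp flip: power_mult_distrib)
      then show ?thesis unfolding N by (simp add: power_divide)
    qed
    also have "\<dots> \<le> (real (m + 1) * 4 ^ (m + 1)) * (3 * 80 ^ m * inverse (Gamma_box m \<delta>))"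
    proof (rule mult_mono)
      have "\<rho>\<^sup>2 / (d * S) \<le> inverse (Gamma_box m \<delta>)"
        using Gamma_box_le_cell_product[OF m(1) \<delta>] d S \<Gamma>
        by (simp add: \<rho>_def d_def S_def s_def divide_simps mult_ac)
      then show "3 * 80 ^ m * (\<rho>\<^sup>2 / (d * S)) \<le> 3 * 80 ^ m * inverse (Gamma_box m \<delta>)"
        by (intro mult_left_mono) auto
    qed (use P(4) d S in auto)
    finally show "real (card (\<Union>p\<in>P. F p)) \<le> real (m + 1) * 4 ^ (m + 1) * 3 * 80 ^ m * inverse (Gamma_box m \<delta>)"
      by (simp add: mult_ac)
  qed
qed

theorem proposition4p12:
  fixes m :: nat
  assumes "m \<ge> 2" and "CARD('n::finite) = m + 1"
  shows "\<exists>c C \<epsilon> :: real. 0 < c \<and> c < C \<and> 0 < \<epsilon> \<and>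
    (\<forall>\<delta>\<in>Delta (m + 1). \<delta> 1 < \<epsilon> \<longrightarrow>
       c * inverse (Gamma_box m \<delta>) \<le> real (box_covering_number (sphere (0 :: real ^ 'n) 1) \<delta>) \<and>
       real (box_covering_number (sphere (0 :: real ^ 'n) 1) \<delta>) \<le> C * inverse (Gamma_box m \<delta>))"
proof -
  define V where "V = measure lborel (ball (0::real ^ 'n) 1)"
  define K where "K = 4 * sqrt (real (m + 1)) * (2 ^ m * (8 + 15 * measure lborel (ball (0::real \<times> real) 1)))"
  define M where "M = real (m + 1) * 4 ^ (m + 1) * 3 * 80 ^ m"
  have V: "V > 0" unfolding V_def by (rule content_ball_pos) simp
  have K: "K > 0" unfolding K_def by (intro mult_pos_pos add_pos_nonneg) auto
  have M: "M > 0" unfolding M_def by simp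
  show ?thesis
  proof (intro exI conjI ballI impI)
    show "0 < V / K" using V K by simp
    show "V / K < M + V / K" using M by simp
    show "0 < 1 / (4 * sqrt (real (m + 1)))" by simp
    fix \<delta> assume \<delta>: "\<delta> \<in> Delta (m + 1)" and small: "\<delta> 1 < 1 / (4 * sqrt (real (m + 1)))"
    have \<Gamma>: "Gamma_box m \<delta> > 0" by (rule Gamma_box_pos[OF \<delta>])
    let ?N = "box_covering_number (sphere (0 :: real ^ 'n) 1) \<delta>"
    let ?Q = "\<lambda>k. \<exists>\<B>. finite \<B> \<and> card \<B> = k \<and> box_cover (sphere (0 :: real ^ 'n) 1) \<delta> \<B>"
    obtain \<B> :: "(real ^ 'n) set set" where \<B>: "finite \<B>" "box_cover (sphere 0 1) \<delta> \<B>"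
      "real (card \<B>) \<le> M * inverse (Gamma_box m \<delta>)"
      using sphere_box_cover_exists[OF assms \<delta>] unfolding M_def by metis
    then have Q: "?Q (card \<B>)" by blast
    have "?Q ?N" unfolding box_covering_number_def using Q by (rule LeastI)
    then obtain \<A> :: "(real ^ 'n) set set" where \<A>: "finite \<A>" "card \<A> = ?N" "box_cover (sphere 0 1) \<delta> \<A>"
      by blast
    have "V \<le> ?N * (K * Gamma_box m \<delta>)"
      using card_box_cover_sphere_ge[OF assms \<delta> less_imp_le[OF small] \<A>(1,3)] \<A>(2) by (simp add: V_def K_def)
    then show "V / K * inverse (Gamma_box m \<delta>) \<le> real ?N"
      using K \<Gamma> by (simp add: divide_simps mult_ac)
    have "?N \<le> card \<B>" unfolding box_covering_number_def using Q by (rule Least_le)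
    then have "real ?N \<le> M * inverse (Gamma_box m \<delta>)" using \<B>(3) by simp
    also have "\<dots> \<le> (M + V / K) * inverse (Gamma_box m \<delta>)"
      using V K \<Gamma> by (intro mult_right_mono) auto
    finally show "real ?N \<le> (M + V / K) * inverse (Gamma_box m \<delta>)" .
  qed
qed

end
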